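(* Let $\widetilde{G}$ be any connected covering Lie group of $SL_2(\mathbb{R})$ (including $SL_2(\mathbb{R})$ itself and its universal cover), with Lie algebra $\mathfrak{sl}_2$ and basis $\{a,b,c\}$ satisfying $[b,a]=c$, $[a,c]=2a$, $[b,c]=-2b$. Consider on $\widetilde G$ the system $\dot q(t)=q(t)\big(a+u_0(t)\,b\big)$ with a real-valued piecewise constant control $u_0$. Then $b$ and $c$ are good Lie brackets for this system, and for every $t_1\ge 0$ the element $e^{t_1(a-b)}$ is small-time approximately reachable. Moreover, if $\widetilde G$ is not the universal cover, this system is small-time controllable on $\widetilde G$.
   Context: For a left-invariant system $\dot q=q(a_0+\sum_i u_ib_i)$ on a connected Lie group $G$ with piecewise constant controls, $q(u,t)$ denotes the solution from the identity. $\mathcal{A}_{st}$ is the set of $q\in G$ such that for every $T>0$ there exist $\tau\in[0,T]$ and a piecewise constant control $u$ on $[0,\tau]$ with $q(u,\tau)=q$. An element is small-time approximately reachable if it lies in the closure $\overline{\mathcal{A}_{st}}$; $X$ in the Lie algebra is a good Lie bracket if $e^{vX}\in\overline{\mathcal{A}_{st}}$ for every $v\in\mathbb{R}$. The system is small-time controllable if $\mathcal{A}_{st}=G$. *)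

theory Defs
  imports "HOL-Analysis.Analysis"
begin

definition SL2 :: "(real^2^2) set" where
  "SL2 = {M. det M = 1}"

definition sl2 :: "(real^2^2) set" where
  "sl2 = {X. trace X = 0}"

fun mpow :: "real^2^2 \<Rightarrow> nat \<Rightarrow> real^2^2" where
  "mpow X 0 = mat 1"
| "mpow X (Suc n) = X ** mpow X n"

definition mexp :: "real^2^2 \<Rightarrow> real^2^2" where
  "mexp X = (\<Sum>n. (1 / fact n) *\<^sub>R mpow X n)"

definition cover_SL2 ::
  "('g::topological_space \<Rightarrow> 'g \<Rightarrow> 'g) \<Rightarrow> 'g \<Rightarrow> ('g \<Rightarrow> 'g) \<Rightarrow> ('g \<Rightarrow> real^2^2) \<Rightarrow> bool" where
  "cover_SL2 mul e ginv p \<longleftrightarrow>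
     (\<forall>x y z. mul (mul x y) z = mul x (mul y z)) \<and>
     (\<forall>x. mul e x = x \<and> mul x e = x) \<and>
     (\<forall>x. mul (ginv x) x = e \<and> mul x (ginv x) = e) \<and>
     continuous_on UNIV (\<lambda>z::'g \<times> 'g. mul (fst z) (snd z)) \<and>
     continuous_on UNIV ginv \<and>
     connected (UNIV :: 'g set) \<and>
     (\<forall>x y. p (mul x y) = p x ** p y) \<and>
     covering_space (UNIV :: 'g set) p SL2"

text \<open>Exponential map of the covering group: the endpoint of the lift, starting at the
  identity, of the one-parameter subgroup t \<mapsto> exp(tX), t \<in> [0,1].\<close>

definition lexp :: "'g::topological_space \<Rightarrow> ('g \<Rightarrow> real^2^2) \<Rightarrow> real^2^2 \<Rightarrow> 'g" where
  "lexp e p X = (THE g. \<exists>\<gamma>. path \<gamma> \<and> pathstart \<gamma> = e \<and> pathfinish \<gamma> = g \<and>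
                          (\<forall>t\<in>{0..1}. p (\<gamma> t) = mexp (t *\<^sub>R X)))"

text \<open>A piecewise constant control is a finite list of pieces (duration t_i \<ge> 0, value u_i).
  The solution of q' = q (a + u b) from the identity at the final time is
  exp(t_1 (a+u_1 b)) \<cdot> ... \<cdot> exp(t_k (a+u_k b)).\<close>

definition endpoint ::
  "('g::topological_space \<Rightarrow> 'g \<Rightarrow> 'g) \<Rightarrow> 'g \<Rightarrow> ('g \<Rightarrow> real^2^2) \<Rightarrow> real^2^2 \<Rightarrow> real^2^2
     \<Rightarrow> (real \<times> real) list \<Rightarrow> 'g" where
  "endpoint mul e p a b us =
     foldl (\<lambda>q (t, u). mul q (lexp e p (t *\<^sub>R (a + u *\<^sub>R b)))) e us"

definition admissible :: "(real \<times> real) list \<Rightarrow> bool" where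
  "admissible us \<longleftrightarrow> (\<forall>(t, u) \<in> set us. 0 \<le> t)"

definition duration :: "(real \<times> real) list \<Rightarrow> real" where
  "duration us = sum_list (map fst us)"

definition Ast ::
  "('g::topological_space \<Rightarrow> 'g \<Rightarrow> 'g) \<Rightarrow> 'g \<Rightarrow> ('g \<Rightarrow> real^2^2) \<Rightarrow> real^2^2 \<Rightarrow> real^2^2 \<Rightarrow> 'g set" where
  "Ast mul e p a b =
     {q. \<forall>T>0. \<exists>us. admissible us \<and> duration us \<le> T \<and> endpoint mul e p a b us = q}"

definition good_bracket ::
  "('g::topological_space \<Rightarrow> 'g \<Rightarrow> 'g) \<Rightarrow> 'g \<Rightarrow> ('g \<Rightarrow> real^2^2) \<Rightarrow> real^2^2 \<Rightarrow> real^2^2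
     \<Rightarrow> real^2^2 \<Rightarrow> bool" where
  "good_bracket mul e p a b X \<longleftrightarrow> (\<forall>v::real. lexp e p (v *\<^sub>R X) \<in> closure (Ast mul e p a b))"

definition small_time_controllable ::
  "('g::topological_space \<Rightarrow> 'g \<Rightarrow> 'g) \<Rightarrow> 'g \<Rightarrow> ('g \<Rightarrow> real^2^2) \<Rightarrow> real^2^2 \<Rightarrow> real^2^2 \<Rightarrow> bool" where
  "small_time_controllable mul e p a b \<longleftrightarrow> Ast mul e p a b = UNIV"

end

theory Submission
  imports Defs
begin

text \<open>Up to conjugation \<open>a\<close> and \<open>b\<close> are the elementary matrices with entry \<open>1\<close> in the lower left and
  upper right corner. The matrices with positive lower left entry are the products
  \<open>e\<^bsup>xb\<^esup> e\<^bsup>sa\<^esup> e\<^bsup>yb\<^esup>\<close> with \<open>s > 0\<close>, and this decomposition lifts to every covering group. A constant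
  control steers the identity to such a product with \<open>x = y\<close>; it needs little time if \<open>s\<close> is small, or if
  \<open>s\<close> is bounded and the trace is large. Three pieces, the outer ones close to powers of \<open>e\<^bsup>b\<^esup>\<close> and
  the middle one of large trace, therefore reach every \<open>e\<^bsup>xb\<^esup> e\<^bsup>sa\<^esup> e\<^bsup>yb\<^esup>\<close> exactly and in arbitrarily
  small time. Letting \<open>s\<close> tend to \<open>0\<close> gives \<open>e\<^bsup>vb\<^esup>\<close> and \<open>e\<^bsup>vc\<^esup>\<close> in the closure, and
  \<open>e\<^bsup>t(a-b)\<^esup>\<close> with \<open>0 < t < \<pi>\<close> is itself of this form. Every element of the covering group is a product
  of such elements and an element of the kernel of the covering, which is generated by the rotation
  \<open>e\<^bsup>2\<pi>(a-b)\<^esup>\<close>; if the cover is not simply connected, this generator has finite order, so the whole kernel is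
  reached by nonnegative rotations.\<close>

section \<open>The exponential of traceless matrices\<close>

definition mat22 :: "real \<Rightarrow> real \<Rightarrow> real \<Rightarrow> real \<Rightarrow> real^2^2" where
  "mat22 \<alpha> \<beta> \<gamma> \<delta> = vector [vector [\<alpha>, \<beta>], vector [\<gamma>, \<delta>]]"

lemma mat22_nth [simp]:
  "mat22 \<alpha> \<beta> \<gamma> \<delta> $ 1 $ 1 = \<alpha>" "mat22 \<alpha> \<beta> \<gamma> \<delta> $ 1 $ 2 = \<beta>"
  "mat22 \<alpha> \<beta> \<gamma> \<delta> $ 2 $ 1 = \<gamma>" "mat22 \<alpha> \<beta> \<gamma> \<delta> $ 2 $ 2 = \<delta>"
  by (simp_all add: mat22_def)

lemma mat22_eta: "mat22 (M $ 1 $ 1) (M $ 1 $ 2) (M $ 2 $ 1) (M $ 2 $ 2) = M"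
  by (simp add: vec_eq_iff forall_2)

lemma mat22_eq_iff [simp]:
  "mat22 \<alpha> \<beta> \<gamma> \<delta> = mat22 \<alpha>' \<beta>' \<gamma>' \<delta>' \<longleftrightarrow> \<alpha> = \<alpha>' \<and> \<beta> = \<beta>' \<and> \<gamma> = \<gamma>' \<and> \<delta> = \<delta>'"
  by (auto simp: vec_eq_iff forall_2)

lemma mat22_arith:
  "mat22 \<alpha> \<beta> \<gamma> \<delta> ** mat22 \<alpha>' \<beta>' \<gamma>' \<delta>' =
     mat22 (\<alpha> * \<alpha>' + \<beta> * \<gamma>') (\<alpha> * \<beta>' + \<beta> * \<delta>') (\<gamma> * \<alpha>' + \<delta> * \<gamma>') (\<gamma> * \<beta>' + \<delta> * \<delta>')"
  "mat22 \<alpha> \<beta> \<gamma> \<delta> + mat22 \<alpha>' \<beta>' \<gamma>' \<delta>' = mat22 (\<alpha> + \<alpha>') (\<beta> + \<beta>') (\<gamma> + \<gamma>') (\<delta> + \<delta>')"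
  "mat22 \<alpha> \<beta> \<gamma> \<delta> - mat22 \<alpha>' \<beta>' \<gamma>' \<delta>' = mat22 (\<alpha> - \<alpha>') (\<beta> - \<beta>') (\<gamma> - \<gamma>') (\<delta> - \<delta>')"
  "r *\<^sub>R mat22 \<alpha> \<beta> \<gamma> \<delta> = mat22 (r * \<alpha>) (r * \<beta>) (r * \<gamma>) (r * \<delta>)"
  "mat 1 = mat22 1 0 0 1"
  by (auto simp: vec_eq_iff forall_2 matrix_matrix_mult_def sum_2 mat_def)

lemma det_mat22 [simp]: "det (mat22 \<alpha> \<beta> \<gamma> \<delta>) = \<alpha> * \<delta> - \<beta> * \<gamma>"
  by (simp add: det_2)

lemma trace_mat22 [simp]: "trace (mat22 \<alpha> \<beta> \<gamma> \<delta>) = \<alpha> + \<delta>"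
  by (simp add: trace_def sum_2)

lemma mat22_in_SL2 [simp]: "mat22 \<alpha> \<beta> \<gamma> \<delta> \<in> SL2 \<longleftrightarrow> \<alpha> * \<delta> - \<beta> * \<gamma> = 1"
  by (simp add: SL2_def)

lemma continuous_on_mat22 [continuous_intros]:
  assumes "continuous_on S f" "continuous_on S g" "continuous_on S h" "continuous_on S k"
  shows "continuous_on S (\<lambda>x. mat22 (f x) (g x) (h x) (k x))"
proof -
  have "mat22 (f x) (g x) (h x) (k x) = (\<chi> i j. if i = 1 then (if j = 1 then f x else g x)
          else (if j = 1 then h x else k x))" for x
    by (simp add: vec_eq_iff forall_2)
  moreover have "continuous_on S (\<lambda>x. if i = (1::2) then (if j = (1::2) then f x else g x)
          else (if j = 1 then h x else k x))" for i j
    using assms by (cases "i = 1"; cases "j = 1"; simp)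
  ultimately show ?thesis
    by (simp only:) (intro continuous_on_vec_lambda)
qed

text \<open>The entire functions \<open>cosh (\<surd>d t)\<close> and \<open>sinh (\<surd>d t) / \<surd>d\<close> of \<open>d\<close>, for \<open>d\<close> of any sign.\<close>

definition cosh_root :: "real \<Rightarrow> real \<Rightarrow> real" where
  "cosh_root d t = (if d > 0 then cosh (sqrt d * t) else if d < 0 then cos (sqrt (- d) * t) else 1)"

definition sinh_root :: "real \<Rightarrow> real \<Rightarrow> real" where
  "sinh_root d t = (if d > 0 then sinh (sqrt d * t) / sqrt d
               else if d < 0 then sin (sqrt (- d) * t) / sqrt (- d) else t)"

lemma cosh_root_sinh_root_0 [simp]: "cosh_root d 0 = 1" "sinh_root d 0 = 0"
  by (simp_all add: cosh_root_def sinh_root_def)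

lemma continuous_on_cosh_root [continuous_intros]:
  fixes f :: "'a::t2_space \<Rightarrow> real"
  assumes "continuous_on S f" shows "continuous_on S (\<lambda>x. cosh_root d (f x))"
  unfolding cosh_root_def using assms
  by (cases "d > 0"; cases "d < 0")
     (auto intro!: continuous_intros)

lemma continuous_on_sinh_root [continuous_intros]:
  fixes f :: "'a::t2_space \<Rightarrow> real"
  assumes "continuous_on S f" shows "continuous_on S (\<lambda>x. sinh_root d (f x))"
  unfolding sinh_root_def using assms
  by (cases "d > 0"; cases "d < 0")
     (auto intro!: continuous_intros)

lemma cosh_root_sinh_root_det: "cosh_root d t * cosh_root d t - d * (sinh_root d t * sinh_root d t) = 1"
proof -
  consider "d > 0" | "d < 0" | "d = 0" by linarith
  then show ?thesis
  proof cases
    case 1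
    then have "d * (sinh_root d t * sinh_root d t) = (sinh (sqrt d * t))\<^sup>2"
      by (simp add: sinh_root_def power2_eq_square field_simps)
    then show ?thesis
      using 1 hyperbolic_pythagoras[of "sqrt d * t"]
      by (simp add: cosh_root_def power2_eq_square)
  next
    case 2
    then have "sqrt (- d) * sqrt (- d) = - d" by simp
    then have "d * (sinh_root d t * sinh_root d t) = - (sin (sqrt (- d) * t))\<^sup>2"
      using 2 by (simp add: sinh_root_def power2_eq_square field_simps)
    then show ?thesis
      using 2 sin_cos_squared_add[of "sqrt (- d) * t"]
      by (simp add: cosh_root_def power2_eq_square)
  qed (simp add: cosh_root_def)
qed

lemma matrix_mult_scaleR:
  fixes X Y :: "real^2^2"
  shows "(r *\<^sub>R X) ** Y = r *\<^sub>R (X ** Y)" "X ** (r *\<^sub>R Y) = r *\<^sub>R (X ** Y)"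
  by (simp_all only: scalar_matrix_assoc matrix_scalar_ac)

lemma matrix_mult_add:
  fixes X Y Z :: "real^2^2"
  shows "(X + Y) ** Z = X ** Z + Y ** Z" "Z ** (X + Y) = Z ** X + Z ** Y"
  by (simp_all add: matrix_matrix_mult_def vec_eq_iff sum.distrib algebra_simps)

lemma mpow_scaleR: "mpow (t *\<^sub>R X) n = t ^ n *\<^sub>R mpow X n"
  by (induction n) (simp_all add: matrix_mult_scaleR mult.commute)

text \<open>As \<open>X ** X\<close> is a multiple of the identity, all powers of \<open>X\<close>
  stay in the span of \<open>mat 1\<close> and \<open>X\<close>. \<open>\<phi> n\<close> and
  \<open>\<psi> n\<close> are the coordinates of \<open>mpow X n\<close>, so the exponential series
  splits into two scalar series.\<close>

lemma mexp_eq_if_sums: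
  fixes \<phi> \<psi> :: "nat \<Rightarrow> real"
  assumes X: "X ** X = d *\<^sub>R mat 1"
    and rec: "\<phi> 0 = 1" "\<psi> 0 = 0" "\<And>n. \<phi> (Suc n) = d * \<psi> n" "\<And>n. \<psi> (Suc n) = \<phi> n"
    and c: "(\<lambda>n. t ^ n / fact n * \<phi> n) sums c" and s: "(\<lambda>n. t ^ n / fact n * \<psi> n) sums s"
  shows "mexp (t *\<^sub>R X) = c *\<^sub>R mat 1 + s *\<^sub>R X"
proof -
  have pow: "mpow X n = \<phi> n *\<^sub>R mat 1 + \<psi> n *\<^sub>R X" for n
    by (induction n)
       (simp_all add: rec X matrix_mult_add matrix_mult_scaleR mult.commute add.commute)
  have "(\<lambda>n. (t ^ n / fact n * \<phi> n) *\<^sub>R mat 1 + (t ^ n / fact n * \<psi> n) *\<^sub>R X) sums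
          (c *\<^sub>R (mat 1 :: real^2^2) + s *\<^sub>R X)"
    by (intro sums_add sums_scaleR_left c s)
  then have "(\<lambda>n. (1 / fact n) *\<^sub>R mpow (t *\<^sub>R X) n) sums (c *\<^sub>R mat 1 + s *\<^sub>R X)"
    by (simp add: mpow_scaleR pow algebra_simps)
  then show ?thesis
    unfolding mexp_def by (rule sums_unique[symmetric])
qed

lemma mexp_scaleR:
  assumes X: "X ** X = d *\<^sub>R mat 1"
  shows "mexp (t *\<^sub>R X) = cosh_root d t *\<^sub>R mat 1 + sinh_root d t *\<^sub>R X"
proof -
  consider "d > 0" | "d < 0" | "d = 0" by linarith
  then show ?thesis
  proof cases
    case 1
    define w where "w = sqrt d"
    have w: "w > 0" "d = w * w" using 1 by (simp_all add: w_def)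
    have ep: "(\<lambda>n. (w * t) ^ n / fact n) sums exp (w * t)"
      using exp_converges[of "w * t"] by (simp add: divide_inverse mult.commute)
    have em: "(\<lambda>n. (- w * t) ^ n / fact n) sums exp (- w * t)"
      using exp_converges[of "- w * t"] by (simp add: divide_inverse mult.commute)
    \<comment> \<open>\<open>\<phi>\<close> is the even part of the sequence \<open>w ^ n\<close>,
      and \<open>\<psi>\<close> is its odd part divided by \<open>w\<close>.\<close>
    have c: "(\<lambda>n. t ^ n / fact n * ((w ^ n + (- w) ^ n) / 2)) sums cosh (w * t)"
      using sums_divide[OF sums_add[OF ep em], of 2]
      unfolding power_mult_distrib by (simp add: cosh_def field_simps)
    have s: "(\<lambda>n. t ^ n / fact n * ((w ^ n - (- w) ^ n) / (2 * w))) sums (sinh (w * t) / w)"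
      using sums_divide[OF sums_diff[OF ep em], of "2 * w"]
      unfolding power_mult_distrib by (simp add: sinh_def field_simps)
    have "mexp (t *\<^sub>R X) = cosh (w * t) *\<^sub>R mat 1 + (sinh (w * t) / w) *\<^sub>R X"
      by (rule mexp_eq_if_sums[OF X _ _ _ _ c s]) (use w in \<open>simp_all add: field_simps\<close>)
    then show ?thesis using 1 by (simp add: cosh_root_def sinh_root_def w_def)
  next
    case 2
    define w where "w = sqrt (- d)"
    have w: "w > 0" "d = - (w * w)" using 2 by (simp_all add: w_def)
    \<comment> \<open>The square roots of \<open>d\<close> are imaginary here; real and imaginary
      parts of the Euler series give the two scalar series.\<close>
    have ep: "(\<lambda>n. (\<i> * complex_of_real (w * t)) ^ n /\<^sub>R fact n) sums exp (\<i> * complex_of_real (w * t))"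
      by (rule exp_converges)
    have eq: "(\<i> * complex_of_real (w * t)) ^ n /\<^sub>R fact n = (t ^ n / fact n) *\<^sub>R (\<i> * complex_of_real w) ^ n" for n
      by (simp add: power_mult_distrib scaleR_conv_of_real divide_inverse)
    have c: "(\<lambda>n. t ^ n / fact n * Re ((\<i> * complex_of_real w) ^ n)) sums cos (w * t)"
      using sums_Re[OF ep] unfolding eq scaleR_complex.sel by (simp only: exp_Euler cos_of_real sin_of_real) simp
    have s: "(\<lambda>n. t ^ n / fact n * (Im ((\<i> * complex_of_real w) ^ n) / w)) sums (sin (w * t) / w)"
      using sums_divide[OF sums_Im[OF ep], of w] unfolding eq scaleR_complex.sel
      by (simp only: exp_Euler cos_of_real sin_of_real) simp
    have "mexp (t *\<^sub>R X) = cos (w * t) *\<^sub>R mat 1 + (sin (w * t) / w) *\<^sub>R X"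
      by (rule mexp_eq_if_sums[OF X _ _ _ _ c s]) (use w in \<open>simp_all add: field_simps\<close>)
    then show ?thesis using 2 by (simp add: cosh_root_def sinh_root_def w_def)
  next
    case 3
    \<comment> \<open>\<open>X\<close> squares to zero, so only the terms of index 0 and 1
      survive.\<close>
    have "(\<lambda>n. t ^ n / fact n * of_bool (n = 0)) sums (\<Sum>n\<in>{0}. t ^ n / fact n * of_bool (n = 0))"
      by (rule sums_finite) auto
    then have c: "(\<lambda>n. t ^ n / fact n * of_bool (n = 0)) sums 1" by simp
    have "(\<lambda>n. t ^ n / fact n * of_bool (n = 1)) sums (\<Sum>n\<in>{1}. t ^ n / fact n * of_bool (n = 1))"
      by (rule sums_finite) auto
    then have s: "(\<lambda>n. t ^ n / fact n * of_bool (n = 1)) sums t" by simp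
    have "mexp (t *\<^sub>R X) = 1 *\<^sub>R mat 1 + t *\<^sub>R X"
      by (rule mexp_eq_if_sums[OF X _ _ _ _ c s]) (use 3 in simp_all)
    then show ?thesis using 3 by (simp add: cosh_root_def sinh_root_def)
  qed
qed

lemma sl2_coords:
  assumes "X \<in> sl2" obtains x y z where "X = mat22 x y z (- x)"
  using that[of "X $ 1 $ 1" "X $ 1 $ 2" "X $ 2 $ 1"] assms mat22_eta[of X]
  by (simp add: sl2_def trace_def sum_2 add_eq_0_iff)

lemma sl2_scaleR: "X \<in> sl2 \<Longrightarrow> t *\<^sub>R X \<in> sl2"
  unfolding sl2_def trace_def sum_2 by (simp add: add_eq_0_iff)

text \<open>Cayley-Hamilton with vanishing trace.\<close>

lemma sl2_square:
  assumes "X \<in> sl2"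
  shows "X ** X = (- det X) *\<^sub>R mat 1"
proof -
  obtain x y z where "X = mat22 x y z (- x)" using assms by (rule sl2_coords)
  then show ?thesis
    by (simp add: mat22_arith)
qed

lemma mexp_sl2:
  assumes "X \<in> sl2"
  shows mexp_sl2_in_SL2: "mexp (t *\<^sub>R X) \<in> SL2"
    and continuous_on_mexp_sl2: "continuous_on S (\<lambda>t. mexp (t *\<^sub>R X))"
proof -
  obtain x y z where X: "X = mat22 x y z (- x)" using assms by (rule sl2_coords)
  have "X ** X = (x * x + y * z) *\<^sub>R mat 1"
    by (simp add: X mat22_arith)
  note mexp = mexp_scaleR[OF this]
  show "mexp (t *\<^sub>R X) \<in> SL2"
    unfolding mexp using cosh_root_sinh_root_det[of "x * x + y * z" t]
    by (simp add: X mat22_arith algebra_simps)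
  show "continuous_on S (\<lambda>t. mexp (t *\<^sub>R X))"
    unfolding mexp by (intro continuous_intros)
qed

lemma mexp_0: "mexp 0 = mat 1"
  using mexp_scaleR[of 0 0 0] by simp

section \<open>Conjugation of matrices\<close>

lemma conj_inverse:
  fixes P Q :: "real^2^2"
  assumes "P ** Q = mat 1"
  shows "P ** (Q ** M ** P) ** Q = M"
proof -
  have "P ** (Q ** M ** P) ** Q = (P ** Q) ** M ** (P ** Q)" by (simp only: matrix_mul_assoc)
  then show ?thesis by (simp add: assms)
qed

lemma conj_mult:
  fixes P Q :: "real^2^2"
  assumes "Q ** P = mat 1"
  shows "(P ** X ** Q) ** (P ** Y ** Q) = P ** (X ** Y) ** Q"
proof -
  have "(P ** X ** Q) ** (P ** Y ** Q) = P ** X ** (Q ** P) ** Y ** Q"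
    by (simp only: matrix_mul_assoc)
  then show ?thesis by (simp add: assms matrix_mul_assoc)
qed

text \<open>Conjugation preserves the scalar \<open>d\<close> with \<open>X ** X\<close> equal to
  \<open>d\<close> times the identity, so \<open>mexp_scaleR\<close> gives both sides with the same
  coefficients.\<close>

lemma mexp_conj:
  assumes "X \<in> sl2" "P ** Q = mat 1" "Q ** P = mat 1"
  shows "mexp (P ** X ** Q) = P ** mexp X ** Q"
proof -
  define d where "d = - det X"
  have X: "X ** X = d *\<^sub>R mat 1" using sl2_square[OF assms(1)] by (simp add: d_def)
  have "(P ** X ** Q) ** (P ** X ** Q) = d *\<^sub>R mat 1"
    by (simp add: conj_mult assms X matrix_mult_scaleR)
  then show ?thesis
    using mexp_scaleR[OF X, of 1] mexp_scaleR[of "P ** X ** Q" d 1]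
    by (simp add: assms matrix_mult_add matrix_mult_scaleR)
qed

section \<open>Lifting to covering spaces of arbitrary topological spaces\<close>

lemma covering_space_sheets:
  assumes "covering_space C p S" "y \<in> S"
  obtains T \<V> where "y \<in> T" "openin (top_of_set S) T" "\<Union>\<V> = C \<inter> p -` T"
    "\<And>U. U \<in> \<V> \<Longrightarrow> openin (top_of_set C) U" "pairwise disjnt \<V>"
    "\<And>U. U \<in> \<V> \<Longrightarrow> \<exists>q. homeomorphism U T p q"
  using assms unfolding covering_space_def by metis

text \<open>Near a point, \<open>f\<close> and \<open>g\<close> each stay in one sheet. Agreement at
  one nearby point forces the sheets to coincide, and \<open>p\<close> is injective on a sheet; so
  agreement spreads, as connected induction requires. Only sheets are used, hence \<open>'a\<close>
  may be any topological space.\<close>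

lemma covering_space_lift_eq:
  fixes p :: "'a::topological_space \<Rightarrow> 'b::topological_space"
    and f g :: "'c::topological_space \<Rightarrow> 'a"
  assumes cov: "covering_space C p S"
    and f: "continuous_on T f" "f \<in> T \<rightarrow> C" and g: "continuous_on T g" "g \<in> T \<rightarrow> C"
    and pfg: "\<And>x. x \<in> T \<Longrightarrow> p (f x) = p (g x)"
    and T: "connected T" "a \<in> T" "x \<in> T" and eq: "f a = g a"
  shows "f x = g x"
proof (rule connected_induction_simple[where P = "\<lambda>x. f x = g x", OF T eq])
  fix b assume b: "b \<in> T"
  have "p (f b) \<in> S"
    using cov f b by (auto simp: covering_space_def)
  then obtain W \<V> where W: "p (f b) \<in> W" "\<Union>\<V> = C \<inter> p -` W"
    "\<And>U. U \<in> \<V> \<Longrightarrow> openin (top_of_set C) U" "pairwise disjnt \<V>"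
    and hom: "\<And>U. U \<in> \<V> \<Longrightarrow> \<exists>q. homeomorphism U W p q"
    using covering_space_sheets[OF cov] by metis
  have "f b \<in> \<Union>\<V>" "g b \<in> \<Union>\<V>"
    using W f g b pfg[OF b] by auto
  then obtain U U' where U: "U \<in> \<V>" "f b \<in> U" "U' \<in> \<V>" "g b \<in> U'" by blast
  have "openin (top_of_set T) ((T \<inter> f -` U) \<inter> (T \<inter> g -` U'))"
    using continuous_openin_preimage[OF f W(3)[OF U(1)]] continuous_openin_preimage[OF g W(3)[OF U(3)]]
    by (rule openin_Int)
  moreover have "f y = g y" if "f x = g x" "f x \<in> U" "g x \<in> U'" "f y \<in> U" "g y \<in> U'" "y \<in> T" for x y
  proof -
    \<comment> \<open>Distinct sheets over \<open>W\<close> are disjoint, while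
      \<open>f x = g x\<close> lies in both.\<close>
    have "U = U'"
      using W(4) U that(1-3) unfolding pairwise_def disjnt_def by auto
    then show ?thesis
      using hom[OF U(1)] pfg[OF that(6)] that(4,5) by (metis homeomorphism_apply1)
  qed
  ultimately show "\<exists>N. openin (top_of_set T) N \<and> b \<in> N \<and> (\<forall>x\<in>N. \<forall>y\<in>N. f x = g x \<longrightarrow> f y = g y)"
    using b U by (intro exI[of _ "(T \<inter> f -` U) \<inter> (T \<inter> g -` U')"]) auto
qed

lemma covering_space_lift_interval:
  fixes p :: "'a::topological_space \<Rightarrow> 'b::topological_space" and a b :: real
  assumes cov: "covering_space C p S" and "a \<le> b"
    and f: "continuous_on {a..b} f" "f \<in> {a..b} \<rightarrow> S" and "x0 \<in> C" "p x0 = f a"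
  obtains g where "continuous_on {a..b} g" "g \<in> {a..b} \<rightarrow> C" "g a = x0"
    "\<And>t. t \<in> {a..b} \<Longrightarrow> p (g t) = f t"
proof -
  \<comment> \<open>Path lifting by bisection. \<open>P c d\<close> allows every starting point over
    \<open>f c\<close>, so that the lift over the right half can start where the lift over the left
    half ends; short intervals map into an evenly covered set.\<close>
  define P where "P c d \<longleftrightarrow> (a \<le> c \<longrightarrow> c \<le> d \<longrightarrow> d \<le> b \<longrightarrow> (\<forall>x\<in>C. p x = f c \<longrightarrow>
    (\<exists>g. continuous_on {c..d} g \<and> g \<in> {c..d} \<rightarrow> C \<and> g c = x \<and> (\<forall>t\<in>{c..d}. p (g t) = f t))))" for c d
  have "P a b" using \<open>a \<le> b\<close>
  proof (induction rule: Bolzano)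
    case (trans c m d)
    show ?case unfolding P_def
    proof (intro impI ballI)
      fix x assume *: "a \<le> c" "d \<le> b" "x \<in> C" "p x = f c"
      obtain g1 where g1: "continuous_on {c..m} g1" "g1 \<in> {c..m} \<rightarrow> C" "g1 c = x" "\<And>t. t \<in> {c..m} \<Longrightarrow> p (g1 t) = f t"
        using trans * unfolding P_def by fastforce
      have "g1 m \<in> C" "p (g1 m) = f m" using g1 trans by auto
      then obtain g2 where g2: "continuous_on {m..d} g2" "g2 \<in> {m..d} \<rightarrow> C" "g2 m = g1 m" "\<And>t. t \<in> {m..d} \<Longrightarrow> p (g2 t) = f t"
        using trans * unfolding P_def by fastforce
      define g where "g t = (if t \<le> m then g1 t else g2 t)" for t
      have "continuous_on ({c..m} \<union> {m..d}) g"
        unfolding g_def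
        by (intro continuous_on_cases) (use g1 g2 in auto)
      then have "continuous_on {c..d} g"
        using trans by (simp add: ivl_disj_un_two_touch)
      then show "\<exists>g. continuous_on {c..d} g \<and> g \<in> {c..d} \<rightarrow> C \<and> g c = x \<and> (\<forall>t\<in>{c..d}. p (g t) = f t)"
        using g1 g2 trans by (intro exI[of _ g]) (auto simp: g_def Pi_iff)
    qed
  next
    case (local x)
    have "f x \<in> S" using f local by auto
    then obtain W \<V> where W: "f x \<in> W" "openin (top_of_set S) W" "\<Union>\<V> = C \<inter> p -` W"
      "\<And>U. U \<in> \<V> \<Longrightarrow> openin (top_of_set C) U"
      and hom: "\<And>U. U \<in> \<V> \<Longrightarrow> \<exists>q. homeomorphism U W p q"
      using covering_space_sheets[OF cov] by metis
    have "openin (top_of_set {a..b}) ({a..b} \<inter> f -` W)"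
      using continuous_openin_preimage[OF f W(2)] .
    moreover have "x \<in> {a..b} \<inter> f -` W" using W(1) local by simp
    ultimately obtain \<epsilon> where \<epsilon>: "\<epsilon> > 0" "ball x \<epsilon> \<inter> {a..b} \<subseteq> {a..b} \<inter> f -` W"
      unfolding openin_contains_ball by meson
    have "P c d" if cd: "c \<le> x" "x \<le> d" "d - c < \<epsilon>" for c d
      unfolding P_def
    proof (intro impI ballI)
      fix z assume *: "a \<le> c" "d \<le> b" "z \<in> C" "p z = f c" "c \<le> d"
      have fW: "f t \<in> W" if "t \<in> {c..d}" for t
      proof -
        have "t \<in> ball x \<epsilon> \<inter> {a..b}" using that cd * by (auto simp: dist_real_def)
        then show ?thesis using \<epsilon> by auto
      qed
      then have "z \<in> \<Union>\<V>" using W(3) * by auto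
      then obtain U q where U: "U \<in> \<V>" "z \<in> U" "homeomorphism U W p q" using hom by blast
      have q: "continuous_on W q" "q ` W = U" "\<And>y. y \<in> W \<Longrightarrow> p (q y) = y" "\<And>y. y \<in> U \<Longrightarrow> q (p y) = y"
        using U(3) by (auto simp: homeomorphism_def)
      have "U \<subseteq> C" using W(3) U(1) by auto
      have "continuous_on {c..d} (q \<circ> f)"
        using * fW by (intro continuous_on_compose continuous_on_subset[OF f(1)] continuous_on_subset[OF q(1)]) auto
      then show "\<exists>g. continuous_on {c..d} g \<and> g \<in> {c..d} \<rightarrow> C \<and> g c = z \<and> (\<forall>t\<in>{c..d}. p (g t) = f t)"
        using q fW U(2) \<open>U \<subseteq> C\<close> *(4) by (intro exI[of _ "q \<circ> f"]) (auto simp flip: *(4))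
    qed
    then show ?case using \<epsilon>(1) by blast
  qed
  then have "\<exists>g. continuous_on {a..b} g \<and> g \<in> {a..b} \<rightarrow> C \<and> g a = x0 \<and> (\<forall>t\<in>{a..b}. p (g t) = f t)"
    using assms unfolding P_def by simp
  then show ?thesis using that by blast
qed

text \<open>Neighbourhoods are transported by \<open>f\<close>, while the sheets remain the same
  sets. This serves to replace the projection of a covering group by a conjugate of it.\<close>

lemma covering_space_compose_homeomorphism:
  assumes cov: "covering_space C p S" and hom: "homeomorphism S S' f g"
  shows "covering_space C (f \<circ> p) S'"
proof (rule covering_spaceI)
  have pim: "p ` C = S" using cov by (simp add: covering_space_def)
  show "continuous_on C (f \<circ> p)"
    using cov hom by (intro continuous_on_compose) (auto simp: covering_space_def homeomorphism_def)
  show "(f \<circ> p) ` C = S'"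
    using pim hom by (auto simp: homeomorphism_def image_comp[symmetric])
  fix y assume y: "y \<in> S'"
  then have "g y \<in> S" using hom by (auto simp: homeomorphism_def)
  then obtain W \<V> where W: "g y \<in> W" "openin (top_of_set S) W" "\<Union>\<V> = C \<inter> p -` W"
      "\<And>U. U \<in> \<V> \<Longrightarrow> openin (top_of_set C) U" "pairwise disjnt \<V>"
      and homW: "\<And>U. U \<in> \<V> \<Longrightarrow> \<exists>q. homeomorphism U W p q"
    using covering_space_sheets[OF cov] by metis
  have "W \<subseteq> S" using W(2) openin_imp_subset by blast
  have "y \<in> f ` W" using W(1) y hom by (metis homeomorphism_apply2 image_eqI)
  moreover have "openin (top_of_set S') (f ` W)" using homeomorphism_imp_open_map[OF hom W(2)] .
  moreover have "\<Union>\<V> = C \<inter> (f \<circ> p) -` (f ` W)"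
  proof -
    have "p x \<in> W \<longleftrightarrow> f (p x) \<in> f ` W" if "x \<in> C" for x
    proof -
      have "p x \<in> S" using that pim by auto
      moreover have "inj_on f S" using hom by (metis homeomorphism_apply1 inj_onI)
      ultimately show ?thesis using \<open>W \<subseteq> S\<close> by (simp add: inj_on_image_mem_iff)
    qed
    then show ?thesis using W(3) by auto
  qed
  moreover have "\<exists>q. homeomorphism U (f ` W) (f \<circ> p) q" if "U \<in> \<V>" for U
  proof -
    obtain q where "homeomorphism U W p q" using homW[OF \<open>U \<in> \<V>\<close>] by blast
    moreover have "homeomorphism W (f ` W) f g"
      using homeomorphism_of_subsets[OF hom \<open>W \<subseteq> S\<close> _ refl, of "{}"] by simp
    ultimately have "homeomorphism U (f ` W) (f \<circ> p) (q \<circ> g)" by (rule homeomorphism_compose)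
    then show ?thesis by (intro exI)
  qed
  ultimately show "\<exists>T. y \<in> T \<and> openin (top_of_set S') T \<and> (\<exists>v. \<Union> v = C \<inter> (f \<circ> p) -` T \<and>
      (\<forall>u\<in>v. openin (top_of_set C) u) \<and> pairwise disjnt v \<and> (\<forall>u\<in>v. \<exists>q. homeomorphism u T (f \<circ> p) q))"
    using W(4,5) by (intro exI[of _ "f ` W"] conjI exI[of _ \<V>]) auto
qed

section \<open>Covering groups of \<open>SL\<^sub>2\<close>\<close>

text \<open>These matrices satisfy the bracket relations required of \<open>a\<close>,
  \<open>b\<close>, \<open>c\<close>; every such triple in \<open>sl2\<close> with
  \<open>a \<noteq> 0\<close> is conjugate to them by \<open>sl2_triple_conj\<close>.\<close>

definition A0 :: "real^2^2" where "A0 = mat22 0 0 1 0"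
definition B0 :: "real^2^2" where "B0 = mat22 0 1 0 0"
definition C0 :: "real^2^2" where "C0 = mat22 1 0 0 (- 1)"

lemma std_in_sl2: "A0 \<in> sl2" "B0 \<in> sl2" "C0 \<in> sl2" "A0 - B0 \<in> sl2" "A0 + u *\<^sub>R B0 \<in> sl2"
  by (simp_all add: sl2_def A0_def B0_def C0_def mat22_arith)

text \<open>\<open>A0\<close> plus \<open>u\<close> times \<open>B0\<close> squares to
  \<open>u\<close> times the identity: the sign of the control decides between hyperbolic, parabolic
  and elliptic motion.\<close>

lemma mexp_control:
  "mexp (t *\<^sub>R (A0 + u *\<^sub>R B0)) = mat22 (cosh_root u t) (u * sinh_root u t) (sinh_root u t) (cosh_root u t)"
  by (subst mexp_scaleR[where d = u]) (simp_all add: A0_def B0_def mat22_arith mult.commute)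

lemma mexp_A0: "mexp (t *\<^sub>R A0) = mat22 1 0 t 1"
  using mexp_control[of t 0] by (simp add: cosh_root_def sinh_root_def)

lemma mexp_B0: "mexp (t *\<^sub>R B0) = mat22 1 t 0 1"
  by (subst mexp_scaleR[where d = 0]) (simp_all add: B0_def mat22_arith cosh_root_def sinh_root_def)

lemma mexp_C0: "mexp (t *\<^sub>R C0) = mat22 (exp t) 0 0 (exp (- t))"
  by (subst mexp_scaleR[where d = 1])
     (simp_all add: C0_def mat22_arith cosh_root_def sinh_root_def cosh_plus_sinh cosh_minus_sinh)

lemma mexp_rotation: "mexp (t *\<^sub>R (A0 - B0)) = mat22 (cos t) (- sin t) (sin t) (cos t)"
  using mexp_control[of t "-1"] by (simp add: cosh_root_def sinh_root_def)

locale sl2_cover =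
  fixes mul :: "'g::topological_space \<Rightarrow> 'g \<Rightarrow> 'g" (infixl "\<cdot>" 70)
    and e :: 'g and ginv :: "'g \<Rightarrow> 'g" and p :: "'g \<Rightarrow> real^2^2"
  assumes cover: "cover_SL2 mul e ginv p"
begin

lemma mul_assoc: "x \<cdot> y \<cdot> z = x \<cdot> (y \<cdot> z)"
  and mul_e [simp]: "e \<cdot> x = x" "x \<cdot> e = x"
  and mul_ginv [simp]: "ginv x \<cdot> x = e" "x \<cdot> ginv x = e"
  and p_mul: "p (x \<cdot> y) = p x ** p y"
  and covering: "covering_space UNIV p SL2"
  and connected_UNIV_g: "connected (UNIV :: 'g set)"
  using cover unfolding cover_SL2_def by blast+

lemma ginv_cancel [simp]: "ginv x \<cdot> (x \<cdot> y) = y" "x \<cdot> (ginv x \<cdot> y) = y"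
  by (simp_all flip: mul_assoc)

lemma mul_left_cancel [simp]: "x \<cdot> y = x \<cdot> z \<longleftrightarrow> y = z"
  by (metis ginv_cancel(1))

lemma mul_right_cancel [simp]: "y \<cdot> x = z \<cdot> x \<longleftrightarrow> y = z"
  by (metis mul_assoc mul_e(2) mul_ginv(2))

lemma continuous_on_mul [continuous_intros]:
  assumes "continuous_on S f" "continuous_on S g"
  shows "continuous_on S (\<lambda>x. f x \<cdot> g x)"
proof -
  have "continuous_on UNIV (\<lambda>z::'g \<times> 'g. fst z \<cdot> snd z)"
    using cover by (simp add: cover_SL2_def)
  from continuous_on_compose2[OF this continuous_on_Pair[OF assms]] show ?thesis by simp
qed

lemma continuous_on_ginv [continuous_intros]:
  assumes "continuous_on S f"
  shows "continuous_on S (\<lambda>x. ginv (f x))"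
proof -
  have "continuous_on UNIV ginv" using cover by (simp add: cover_SL2_def)
  from continuous_on_compose2[OF this assms] show ?thesis by simp
qed

lemma continuous_on_p [continuous_intros]:
  assumes "continuous_on S f"
  shows "continuous_on S (\<lambda>x. p (f x))"
  using continuous_on_compose2[OF covering_space_imp_continuous[OF covering] assms] by simp

lemma p_in_SL2 [simp]: "p x \<in> SL2"
  using covering_space_imp_surjective[OF covering] by auto

lemma p_e [simp]: "p e = mat 1"
proof -
  have "mat 1 \<in> p ` UNIV"
    unfolding covering_space_imp_surjective[OF covering] by (simp add: SL2_def det_I)
  then obtain x where "p x = mat 1" by (metis imageE)
  then show ?thesis
    using p_mul[of x e] by simp
qed

lemma p_ginv: "p (ginv x) ** p x = mat 1" "p x ** p (ginv x) = mat 1"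
  by (simp_all flip: p_mul)

text \<open>The main device for identities in the cover: compare the projections in
  \<open>SL2\<close>, and the elements themselves at a single parameter.\<close>

lemma lift_eq:
  fixes f g :: "'c::topological_space \<Rightarrow> 'g"
  assumes "continuous_on T f" "continuous_on T g" "\<And>x. x \<in> T \<Longrightarrow> p (f x) = p (g x)"
    "connected T" "a \<in> T" "f a = g a" "x \<in> T"
  shows "f x = g x"
  using covering_space_lift_eq[OF covering, of T f g a x] assms by simp

section \<open>The exponential map of the covering group\<close>

abbreviation gexp :: "real^2^2 \<Rightarrow> real \<Rightarrow> 'g" where
  "gexp X t \<equiv> lexp e p (t *\<^sub>R X)"

text \<open>Uniqueness of lifts makes the definite description in \<open>lexp\<close> well defined,
  so any lift computes it.\<close>

lemma lexp_eq:
  assumes "continuous_on {0..1} \<gamma>" "\<gamma> 0 = e" "\<And>t. t \<in> {0..1} \<Longrightarrow> p (\<gamma> t) = mexp (t *\<^sub>R X)"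
  shows "lexp e p X = \<gamma> 1"
  unfolding lexp_def
proof (rule the_equality)
  show "\<exists>\<gamma>'. path \<gamma>' \<and> pathstart \<gamma>' = e \<and> pathfinish \<gamma>' = \<gamma> 1 \<and> (\<forall>t\<in>{0..1}. p (\<gamma>' t) = mexp (t *\<^sub>R X))"
    using assms by (intro exI[of _ \<gamma>]) (auto simp: path_def pathstart_def pathfinish_def)
  fix g assume "\<exists>\<gamma>'. path \<gamma>' \<and> pathstart \<gamma>' = e \<and> pathfinish \<gamma>' = g \<and> (\<forall>t\<in>{0..1}. p (\<gamma>' t) = mexp (t *\<^sub>R X))"
  then obtain \<gamma>' where \<gamma>': "continuous_on {0..1} \<gamma>'" "\<gamma>' 0 = e" "\<gamma>' 1 = g"
    "\<And>t. t \<in> {0..1} \<Longrightarrow> p (\<gamma>' t) = mexp (t *\<^sub>R X)"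
    by (auto simp: path_def pathstart_def pathfinish_def)
  have "\<gamma>' 1 = \<gamma> 1"
    by (rule lift_eq[of "{0..1::real}" _ _ 0]) (use assms \<gamma>' in auto)
  then show "g = \<gamma> 1" using \<gamma>' by simp
qed

text \<open>A single lift computes \<open>gexp X\<close> on a whole interval around 0; projection
  and continuity of \<open>gexp X\<close> are read off from it.\<close>

lemma gexp_lift:
  assumes X: "X \<in> sl2" and "N > 0"
  obtains h where "continuous_on {-N..N} h" "h 0 = e" "\<And>t. t \<in> {-N..N} \<Longrightarrow> p (h t) = mexp (t *\<^sub>R X)"
    "\<And>t. t \<in> {-N..N} \<Longrightarrow> gexp X t = h t"
proof -
  have "mexp (- N *\<^sub>R X) \<in> p ` UNIV"
    using mexp_sl2_in_SL2[OF X, of "- N"] covering_space_imp_surjective[OF covering] by (simp only:)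
  then obtain x0 where x0: "p x0 = mexp (- N *\<^sub>R X)" by (metis imageE)
  obtain k where k: "continuous_on {-N..N} k" "\<And>t. t \<in> {-N..N} \<Longrightarrow> p (k t) = mexp (t *\<^sub>R X)"
    using \<open>N > 0\<close> mexp_sl2_in_SL2[OF X] x0
    by (rule_tac covering_space_lift_interval[OF covering _ continuous_on_mexp_sl2[OF X], of "-N" N x0]) auto
  \<comment> \<open>Path lifting starts at \<open>-N\<close>, over an arbitrary preimage. Left
    translation by \<open>ginv (k 0)\<close>, which lies in the kernel of \<open>p\<close>, moves
    the value at 0 to \<open>e\<close> and preserves the projection.\<close>
  define h where "h t = ginv (k 0) \<cdot> k t" for t
  have "p (k 0) = mat 1" using k(2)[of 0] \<open>N > 0\<close> by (simp add: mexp_0)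
  then have "p (ginv (k 0)) = mat 1" using p_ginv(1)[of "k 0"] by simp
  then have ph: "p (h t) = mexp (t *\<^sub>R X)" if "t \<in> {-N..N}" for t
    using k(2)[OF that] by (simp add: h_def p_mul)
  have ch: "continuous_on {-N..N} h"
    unfolding h_def by (intro continuous_intros k)
  have "gexp X t = h t" if t: "t \<in> {-N..N}" for t
  proof -
    have s: "s * t \<in> {-N..N}" if "s \<in> {0..1}" for s
    proof -
      have "\<bar>s * t\<bar> \<le> 1 * \<bar>t\<bar>" using that unfolding abs_mult by (intro mult_right_mono) auto
      then show ?thesis using t by auto
    qed
    \<comment> \<open>\<open>lexp\<close> asks for a path on the unit interval, so \<open>h\<close>
      is rescaled by \<open>t\<close>.\<close>
    have "continuous_on {0..1} (\<lambda>s. h (s * t))"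
      by (rule continuous_on_compose2[OF ch]) (use s in \<open>auto intro!: continuous_intros\<close>)
    then have "gexp X t = h (1 * t)"
      by (rule lexp_eq) (use s ph in \<open>auto simp: h_def\<close>)
    then show ?thesis by simp
  qed
  then show ?thesis using that[of h] ch ph by (simp add: h_def)
qed

lemma p_gexp:
  assumes "X \<in> sl2" shows "p (gexp X t) = mexp (t *\<^sub>R X)"
proof -
  have "\<bar>t\<bar> + 1 > 0" by simp
  then obtain h where h: "\<And>s. s \<in> {-(\<bar>t\<bar> + 1)..\<bar>t\<bar> + 1} \<Longrightarrow> p (h s) = mexp (s *\<^sub>R X)"
    "\<And>s. s \<in> {-(\<bar>t\<bar> + 1)..\<bar>t\<bar> + 1} \<Longrightarrow> gexp X s = h s"
    using gexp_lift[OF assms] by metis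
  have "t \<in> {-(\<bar>t\<bar> + 1)..\<bar>t\<bar> + 1}" by auto
  then show ?thesis using h by simp
qed

lemma gexp_0 [simp]: "lexp e p 0 = e"
  using lexp_eq[of "\<lambda>_. e" 0] by (simp add: mexp_0)

lemma continuous_on_gexp_UNIV: "X \<in> sl2 \<Longrightarrow> continuous_on UNIV (gexp X)"
proof (rule continuous_at_imp_continuous_on, rule ballI)
  fix t :: real assume X: "X \<in> sl2"
  define N where "N = \<bar>t\<bar> + 1"
  have "N > 0" by (simp add: N_def)
  then obtain h where h: "continuous_on {-N..N} h" "\<And>t. t \<in> {-N..N} \<Longrightarrow> gexp X t = h t"
    using gexp_lift[OF X] by metis
  then have "continuous_on {-N..N} (gexp X)" by (subst continuous_on_cong[OF refl, of _ _ h]) auto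
  moreover have "t \<in> interior {-N..N}" by (auto simp: N_def)
  ultimately show "isCont (gexp X) t" by (rule continuous_on_interior)
qed

lemma continuous_on_gexp [continuous_intros]:
  assumes "X \<in> sl2" "continuous_on S f"
  shows "continuous_on S (\<lambda>x. gexp X (f x))"
  using continuous_on_compose2[OF continuous_on_gexp_UNIV[OF assms(1)] assms(2)] by simp

abbreviation "Ea \<equiv> gexp A0"
abbreviation "Eb \<equiv> gexp B0"
abbreviation "Ec \<equiv> gexp C0"
abbreviation "Er \<equiv> gexp (A0 - B0)"

lemma p_E:
  "p (Ea t) = mat22 1 0 t 1" "p (Eb t) = mat22 1 t 0 1"
  "p (Ec t) = mat22 (exp t) 0 0 (exp (- t))" "p (Er t) = mat22 (cos t) (- sin t) (sin t) (cos t)"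
  by (simp_all only: p_gexp std_in_sl2 mexp_A0 mexp_B0 mexp_C0 mexp_rotation)

lemmas continuous_on_E [continuous_intros] = std_in_sl2[THEN continuous_on_gexp]

lemma lift_eq_real:
  fixes f g :: "real \<Rightarrow> 'g"
  assumes "continuous_on {0..t} f" "continuous_on {0..t} g"
    "\<And>x. 0 \<le> x \<Longrightarrow> x \<le> t \<Longrightarrow> p (f x) = p (g x)" "0 \<le> t" "f 0 = g 0"
  shows "f t = g t"
  by (rule lift_eq[of "{0..t}" f g 0]) (use assms in auto)

text \<open>For fixed \<open>s\<close>, both sides lift the same curve in \<open>t\<close> and agree
  at \<open>t = 0\<close>.\<close>

lemma gexp_add:
  assumes "X \<in> sl2" "\<And>s t. mexp ((s + t) *\<^sub>R X) = mexp (s *\<^sub>R X) ** mexp (t *\<^sub>R X)"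
  shows "gexp X (s + t) = gexp X s \<cdot> gexp X t"
proof (rule lift_eq[of UNIV "\<lambda>t. gexp X (s + t)" "\<lambda>t. gexp X s \<cdot> gexp X t" 0])
  show "p (gexp X (s + t)) = p (gexp X s \<cdot> gexp X t)" for t
    by (simp only: p_mul p_gexp[OF assms(1)] assms(2))
next
  show "continuous_on UNIV (\<lambda>t. gexp X (s + t))" "continuous_on UNIV (\<lambda>t. gexp X s \<cdot> gexp X t)"
    by (intro continuous_on_mul continuous_on_gexp[OF assms(1)] continuous_on_add continuous_on_const continuous_on_id)+
qed simp_all

lemma Eb_add: "Eb (s + t) = Eb s \<cdot> Eb t"
  by (rule gexp_add) (simp_all only: std_in_sl2 mexp_B0, simp add: mat22_arith)

lemma Er_add: "Er (s + t) = Er s \<cdot> Er t"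
  by (rule gexp_add) (simp_all only: std_in_sl2 mexp_rotation, simp add: mat22_arith cos_add sin_add)

end

section \<open>Reachability in small time\<close>

text \<open>Half-angle formula and \<open>y \<le> sinh y\<close> for \<open>y \<ge> 0\<close>. The
  bound enters the time estimate for hyperbolic pieces.\<close>

lemma cosh_real_ge_quadratic: "1 + x\<^sup>2 / 2 \<le> cosh x" for x :: real
proof -
  have sinh_ge: "y \<le> sinh y" if "y \<ge> 0" for y :: real
  proof -
    have "sinh 0 - 0 \<le> sinh y - y"
    proof (rule DERIV_nonneg_imp_nondecreasing[OF that])
      fix z :: real
      have "((\<lambda>y. sinh y - y) has_real_derivative cosh z - 1) (at z)"
        by (auto intro!: derivative_eq_intros)
      then show "\<exists>d. ((\<lambda>y. sinh y - y) has_real_derivative d) (at z) \<and> 0 \<le> d"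
        using cosh_real_ge_1 by (intro exI[of _ "cosh z - 1"]) simp
    qed
    then show ?thesis by simp
  qed
  have "\<bar>x / 2\<bar>\<^sup>2 \<le> (sinh \<bar>x / 2\<bar>)\<^sup>2"
    by (intro power_mono sinh_ge) auto
  then have "x\<^sup>2 / 4 \<le> (sinh (x / 2))\<^sup>2"
    by (simp add: power_divide) (cases "x \<ge> 0"; simp add: abs_if)
  moreover have "cosh x = 1 + 2 * (sinh (x / 2))\<^sup>2"
    using cosh_double[of "x / 2"] by (simp add: cosh_square_eq)
  ultimately show ?thesis by simp
qed

context sl2_cover
begin

text \<open>For \<open>s > 0\<close> these elements are the lifts, on the sheet adjacent to the identity, of the matrices with positive
  lower left entry.\<close>

definition H :: "real \<Rightarrow> real \<Rightarrow> real \<Rightarrow> 'g" where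
  "H x s y = Eb x \<cdot> Ea s \<cdot> Eb y"

lemma p_H: "p (H x s y) = mat22 (1 + x * s) (x + y + x * s * y) s (1 + s * y)"
  by (simp add: H_def p_mul p_E mat22_arith algebra_simps)

lemma continuous_on_H [continuous_intros]:
  assumes "continuous_on S f" "continuous_on S g" "continuous_on S h"
  shows "continuous_on S (\<lambda>x. H (f x) (g x) (h x))"
  unfolding H_def by (intro continuous_on_mul continuous_on_E assms)

lemma H_0: "H x 0 y = Eb (x + y)"
  by (simp add: H_def Eb_add)

text \<open>Writing the parameter as \<open>u s / (1 + c)\<close> instead of \<open>(c - 1) / s\<close> keeps it continuous at time \<open>0\<close>.\<close>

lemma gexp_control_eq_H:
  assumes t: "0 \<le> t" and c: "\<And>\<tau>. 0 \<le> \<tau> \<Longrightarrow> \<tau> \<le> t \<Longrightarrow> cosh_root u \<tau> > - 1"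
  shows "gexp (A0 + u *\<^sub>R B0) t =
    H (u * sinh_root u t / (1 + cosh_root u t)) (sinh_root u t) (u * sinh_root u t / (1 + cosh_root u t))"
proof (rule lift_eq_real[OF _ _ _ t])
  \<comment> \<open>The bound on \<open>cosh_root\<close> along the whole interval keeps the
    denominator nonzero, so the right-hand side is a continuous lift starting at
    \<open>e\<close>.\<close>
  have "continuous_on {0..t} (\<lambda>t. u * sinh_root u t / (1 + cosh_root u t))"
    using c by (intro continuous_intros) (force simp: add_eq_0_iff)
  then show "continuous_on {0..t}
     (\<lambda>t. H (u * sinh_root u t / (1 + cosh_root u t)) (sinh_root u t) (u * sinh_root u t / (1 + cosh_root u t)))"
    by (intro continuous_on_H continuous_on_sinh_root continuous_on_id)
  show "continuous_on {0..t} (\<lambda>t. gexp (A0 + u *\<^sub>R B0) t)"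
    by (intro continuous_intros std_in_sl2)
  fix \<tau> assume "0 \<le> \<tau>" "\<tau> \<le> t"
  define c s x where "c = cosh_root u \<tau>" and "s = sinh_root u \<tau>" and "x = u * s / (1 + c)"
  have "1 + c > 0" using \<open>0 \<le> \<tau>\<close> \<open>\<tau> \<le> t\<close> assms(2)[of \<tau>] by (simp add: c_def)
  then have x: "x * (1 + c) = u * s" by (simp add: x_def)
  \<comment> \<open>Determinant 1 yields \<open>x * s = c - 1\<close>, which makes both diagonal
    entries of \<open>p (H x s x)\<close> equal to \<open>c\<close>.\<close>
  have det: "(c - 1) * (1 + c) = u * s * s"
    using cosh_root_sinh_root_det[of u \<tau>] by (simp add: c_def s_def algebra_simps)
  then have "(x * s) * (1 + c) = (c - 1) * (1 + c)" using x by (metis mult.assoc mult.commute)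
  then have xs: "x * s = c - 1" using \<open>1 + c > 0\<close> by simp
  have "x + x + x * s * x = x * (1 + c)" unfolding xs by (simp add: algebra_simps)
  then have "p (H x s x) = mat22 c (u * s) s c"
    using xs x by (simp add: p_H mult.commute)
  then show "p (gexp (A0 + u *\<^sub>R B0) \<tau>) =
      p (H (u * sinh_root u \<tau> / (1 + cosh_root u \<tau>)) (sinh_root u \<tau>) (u * sinh_root u \<tau> / (1 + cosh_root u \<tau>)))"
    unfolding p_gexp[OF std_in_sl2(5)] mexp_control by (simp add: c_def s_def x_def)
next show "gexp (A0 + u *\<^sub>R B0) 0 = H (u * sinh_root u 0 / (1 + cosh_root u 0)) (sinh_root u 0) (u * sinh_root u 0 / (1 + cosh_root u 0))" by (simp add: H_0)
qed

section \<open>Concatenation of controls and time estimates\<close>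

definition reach :: "real \<Rightarrow> 'g \<Rightarrow> bool" where
  "reach T g \<longleftrightarrow> (\<exists>us. admissible us \<and> duration us \<le> T \<and> endpoint mul e p A0 B0 us = g)"

lemma Ast_iff_reach: "g \<in> Ast mul e p A0 B0 \<longleftrightarrow> (\<forall>T>0. reach T g)"
  by (simp add: Ast_def reach_def)

text \<open>Left invariance: starting the fold at \<open>q\<close> instead of \<open>e\<close>
  multiplies the result by \<open>q\<close> from the left.\<close>

lemma endpoint_append:
  "endpoint mul e p a b (us @ vs) = endpoint mul e p a b us \<cdot> endpoint mul e p a b vs"
proof -
  define F where "F = (\<lambda>q (t, u). q \<cdot> lexp e p (t *\<^sub>R (a + u *\<^sub>R b)))"
  have "foldl F q ws = q \<cdot> foldl F e ws" for q ws
  proof (induction ws arbitrary: q)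
    case (Cons w ws)
    have "foldl F q (w # ws) = F q w \<cdot> foldl F e ws" by (simp add: Cons[of "F q w"])
    also have "\<dots> = q \<cdot> (F e w \<cdot> foldl F e ws)" by (simp add: F_def mul_assoc split: prod.split)
    also have "F e w \<cdot> foldl F e ws = foldl F e (w # ws)" by (simp add: Cons[of "F e w"])
    finally show ?case .
  qed simp
  then have "foldl F e (us @ vs) = foldl F e us \<cdot> foldl F e vs" by (metis foldl_append)
  then show ?thesis unfolding endpoint_def F_def .
qed

lemma reach_mul:
  assumes "reach T x" "reach T' y" shows "reach (T + T') (x \<cdot> y)"
proof -
  obtain us vs where "admissible us" "duration us \<le> T" "endpoint mul e p A0 B0 us = x"
    "admissible vs" "duration vs \<le> T'" "endpoint mul e p A0 B0 vs = y"
    using assms unfolding reach_def by blast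
  then show ?thesis
    unfolding reach_def
    by (intro exI[of _ "us @ vs"]) (auto simp: endpoint_append admissible_def duration_def)
qed

lemma reach_mono:
  assumes "reach T x" "T \<le> T'" shows "reach T' x"
proof -
  obtain us where "admissible us" "duration us \<le> T" "endpoint mul e p A0 B0 us = x"
    using assms(1) unfolding reach_def by blast
  then show ?thesis
    using assms(2) unfolding reach_def by (intro exI[of _ us]) simp
qed

lemma reach_piece: "0 \<le> t \<Longrightarrow> t \<le> T \<Longrightarrow> reach T (gexp (A0 + u *\<^sub>R B0) t)"
  unfolding reach_def
  by (rule exI[of _ "[(t, u)]"]) (simp add: admissible_def duration_def endpoint_def)

text \<open>One piece with control \<open>u \<ge> 0\<close>. Writing
  \<open>1 + x * s = cosh \<theta>\<close>, it takes time
  \<open>t = s * \<theta> / sinh \<theta>\<close>, and the quadratic bound on \<open>cosh\<close>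
  shows that the square of \<open>t\<close> is at most \<open>2 * s\<^sup>2 / (2 + x * s)\<close>. A
  large trace thus compensates for an \<open>s\<close> that is not small.\<close>

lemma reach_H_hyperbolic:
  assumes s: "s > 0" and xs: "x * s \<ge> 0" and T: "T > 0" "2 * s\<^sup>2 \<le> T\<^sup>2 * (2 + x * s)"
  shows "reach T (H x s x)"
proof (cases "x = 0")
  case True
  then have "s \<le> T" using T by (simp add: power2_le_iff_abs_le abs_le_square_iff)
  then show ?thesis
    using reach_piece[of s T 0] gexp_control_eq_H[of s 0] s True
    by (simp add: cosh_root_def sinh_root_def)
next
  case False
  then have x: "x > 0" using s xs by (simp add: zero_le_mult_iff)
  define c where "c = 1 + x * s"
  have c: "c > 1" using x s by (simp add: c_def)
  define \<theta> where "\<theta> = arcosh c"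
  have \<theta>: "\<theta> > 0" "cosh \<theta> = c"
    using c arcosh_nonneg_real[of c] arcosh_eq_0_iff_real[of c] by (auto simp: \<theta>_def less_le simp del: arcosh_eq_0_iff_real)
  have sinh: "sinh \<theta> > 0" "(sinh \<theta>)\<^sup>2 = (c - 1) * (c + 1)"
    using \<theta> hyperbolic_pythagoras[of \<theta>] by (auto simp: power2_eq_square algebra_simps)
  \<comment> \<open>The frequency for which \<open>sinh (w * t) / w = s\<close> when
    \<open>w * t = \<theta>\<close>; the control is the square of \<open>w\<close>.\<close>
  define w where "w = sinh \<theta> / s"
  have w: "w > 0" "sqrt (w\<^sup>2) = w" using sinh s by (auto simp: w_def)
  define t where "t = \<theta> / w"
  have wt: "w * t = \<theta>" "t > 0" using w \<theta> by (auto simp: t_def)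
  have cf: "cosh_root (w\<^sup>2) t = c" and sf: "sinh_root (w\<^sup>2) t = s"
    using w wt \<theta> sinh s by (simp_all add: cosh_root_def sinh_root_def w_def)
  have "w\<^sup>2 * s = x * (1 + c)"
    using s sinh by (simp add: w_def power_divide power2_eq_square) (simp add: c_def)
  then have "w\<^sup>2 * s / (1 + c) = x" using c by simp
  moreover have "cosh_root (w\<^sup>2) \<tau> > - 1" for \<tau>
    using w cosh_real_ge_1[of "w * \<tau>"] by (simp add: cosh_root_def)
  ultimately have eq: "gexp (A0 + w\<^sup>2 *\<^sub>R B0) t = H x s x"
    using gexp_control_eq_H[of t "w\<^sup>2"] wt cf sf by simp
  have "\<theta>\<^sup>2 \<le> 2 * (c - 1)" using cosh_real_ge_quadratic[of \<theta>] \<theta> by simp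
  then have "s\<^sup>2 * \<theta>\<^sup>2 / (sinh \<theta>)\<^sup>2 \<le> s\<^sup>2 * (2 * (c - 1)) / (sinh \<theta>)\<^sup>2"
    by (intro divide_right_mono mult_left_mono) auto
  moreover have "t\<^sup>2 = s\<^sup>2 * \<theta>\<^sup>2 / (sinh \<theta>)\<^sup>2"
    by (simp add: t_def w_def power_divide power_mult_distrib)
  ultimately have "t\<^sup>2 \<le> s\<^sup>2 * (2 * (c - 1)) / ((c - 1) * (c + 1))"
    by (simp only: sinh(2))
  also have "\<dots> = ((c - 1) * (2 * s\<^sup>2)) / ((c - 1) * (c + 1))" by (simp only: mult_ac)
  also have "\<dots> = 2 * s\<^sup>2 / (c + 1)" using c by (intro mult_divide_mult_cancel_left) simp
  also have "\<dots> \<le> T\<^sup>2" using T(2) c by (simp add: c_def field_simps)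
  finally have "t \<le> T" using T(1) by (intro power2_le_imp_le[of t T]) auto
  then show ?thesis using reach_piece[of t T "w\<^sup>2"] wt eq by simp
qed

text \<open>For \<open>x < 0\<close> the piece is elliptic, with
  \<open>1 + x * s = cos \<theta>\<close> and time \<open>s * \<theta> / sin \<theta>\<close>. The
  lower bound 1/2 on the cosine gives \<open>\<theta> \<le> 2 * sin \<theta>\<close>, hence time at
  most \<open>2 * s\<close>.\<close>

lemma reach_H_symmetric:
  assumes s: "s > 0" and xs: "1 + x * s \<ge> 1 / 2" and T: "2 * s \<le> T"
  shows "reach T (H x s x)"
proof (cases "x \<ge> 0")
  case True
  have "(2 * s)\<^sup>2 \<le> T\<^sup>2" using s T by (intro power_mono) auto
  then have "4 * s\<^sup>2 \<le> T\<^sup>2" by (simp add: power_mult_distrib)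
  then have "2 * s\<^sup>2 * 2 \<le> T\<^sup>2 * 2" using zero_le_power2[of s] by linarith
  also have "\<dots> \<le> T\<^sup>2 * (2 + x * s) * 2" using True s by (simp add: algebra_simps)
  finally have "2 * s\<^sup>2 \<le> T\<^sup>2 * (2 + x * s)" by simp
  then show ?thesis using reach_H_hyperbolic True s T by simp
next
  case False
  define c where "c = 1 + x * s"
  have c: "1 / 2 \<le> c" "c < 1" using xs False s by (auto simp: c_def mult_less_0_iff)
  define \<theta> where "\<theta> = arccos c"
  have \<theta>: "0 < \<theta>" "\<theta> < pi" "cos \<theta> = c"
    using c arccos_lt_bounded[of c] by (auto simp: \<theta>_def)
  have sin: "sin \<theta> > 0" "(sin \<theta>)\<^sup>2 = (1 - c) * (1 + c)"
    using \<theta> sin_gt_zero by (auto simp: sin_squared_eq power2_eq_square algebra_simps)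
  define w where "w = sin \<theta> / s"
  have w: "w > 0" "sqrt (w\<^sup>2) = w" using sin s by (auto simp: w_def)
  define t where "t = \<theta> / w"
  have wt: "w * t = \<theta>" "t > 0" using w \<theta> by (auto simp: t_def)
  have cf: "cosh_root (- w\<^sup>2) \<tau> = cos (w * \<tau>)" for \<tau>
    using w by (simp add: cosh_root_def)
  have sf: "sinh_root (- w\<^sup>2) t = s"
    using w wt sin s by (simp add: sinh_root_def w_def)
  have "w\<^sup>2 * s = - x * (1 + c)"
    using s sin by (simp add: w_def power_divide power2_eq_square) (simp add: c_def)
  then have "- w\<^sup>2 * s / (1 + c) = x" using c by (simp add: field_simps)
  moreover have "cosh_root (- w\<^sup>2) \<tau> > - 1" if "0 \<le> \<tau>" "\<tau> \<le> t" for \<tau>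
  proof -
    \<comment> \<open>The angle has not passed \<open>\<theta> < pi\<close>, so the cosine is still
      at least \<open>c\<close>.\<close>
    have "w * \<tau> \<le> \<theta>" using that w wt(1) by (metis mult_left_mono less_imp_le)
    then have "cos \<theta> \<le> cos (w * \<tau>)" using that w \<theta> by (intro cos_monotone_0_pi_le) auto
    then show ?thesis using \<theta> c by (simp add: cf)
  qed
  ultimately have eq: "gexp (A0 + (- w\<^sup>2) *\<^sub>R B0) t = H x s x"
    using gexp_control_eq_H[of t "- w\<^sup>2"] wt sf \<theta> by (simp add: cf)
  \<comment> \<open>Mean value theorem for \<open>sin\<close>, with \<open>cos\<close> decreasing on
    the interval.\<close>
  have "\<theta> * c \<le> sin \<theta>"
  proof -
    obtain z where z: "0 < z" "z < \<theta>" "sin \<theta> - sin 0 = (\<theta> - 0) * cos z"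
      using MVT2[of 0 \<theta> sin cos] \<theta> DERIV_sin by blast
    have "cos \<theta> \<le> cos z" using z \<theta> by (intro cos_monotone_0_pi_le) auto
    then show ?thesis using z \<theta> by simp
  qed
  moreover have "\<theta> * (1 / 2) \<le> \<theta> * c" using \<theta> c by (intro mult_left_mono) auto
  ultimately have "\<theta> \<le> 2 * sin \<theta>" by simp
  then have "t \<le> 2 * s" using sin s by (simp add: t_def w_def field_simps)
  then show ?thesis using reach_piece[of t T "- w\<^sup>2"] wt eq T by simp
qed

text \<open>Both sides are lifts of the same path when \<open>s1\<close> and \<open>s2\<close> are scaled by \<open>r \<in> [0, 1]\<close>.\<close>

lemma Ea_Eb_Ea:
  assumes "s1 \<ge> 0" "s2 \<ge> 0" "s1 + s2 > 0" and \<Gamma>: "\<Gamma> = s1 + s2 + z * s1 * s2" "\<Gamma> > 0"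
  shows "Ea s1 \<cdot> Eb z \<cdot> Ea s2 = H (z * s2 / \<Gamma>) \<Gamma> (z * s1 / \<Gamma>)"
proof -
  \<comment> \<open>After scaling \<open>s1\<close> and \<open>s2\<close> by \<open>r\<close> the
    lower left entry is \<open>r * D r\<close>. Separating the factor \<open>r\<close> keeps the
    quotients defined at \<open>r = 0\<close>, where both sides are \<open>Eb z\<close>;
    \<open>D\<close> interpolates linearly between the positive numbers \<open>s1 + s2\<close> and
    \<open>\<Gamma>\<close>.\<close>
  define D where "D r = s1 + s2 + r * (z * s1 * s2)" for r
  have D: "D r > 0" if "0 \<le> r" "r \<le> 1" for r
  proof -
    have "D r = (1 - r) * (s1 + s2) + r * \<Gamma>" by (simp add: D_def \<Gamma> algebra_simps)
    moreover have "(1 - r) * (s1 + s2) \<ge> 0" "r * \<Gamma> \<ge> 0" using that assms by auto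
    moreover have "(1 - r) * (s1 + s2) > 0 \<or> r * \<Gamma> > 0" using that assms by (cases "r = 0") auto
    ultimately show ?thesis by linarith
  qed
  have "Ea (1 * s1) \<cdot> Eb z \<cdot> Ea (1 * s2) = H (z * s2 / D 1) (1 * D 1) (z * s1 / D 1)"
  proof (rule lift_eq_real[of 1 "\<lambda>r. Ea (r * s1) \<cdot> Eb z \<cdot> Ea (r * s2)"
        "\<lambda>r. H (z * s2 / D r) (r * D r) (z * s1 / D r)"])
    show "continuous_on {0..1} (\<lambda>r. Ea (r * s1) \<cdot> Eb z \<cdot> Ea (r * s2))"
      by (intro continuous_on_mul continuous_on_E continuous_intros)
    have "continuous_on {0..1} D" unfolding D_def by (intro continuous_intros)
    then show "continuous_on {0..1} (\<lambda>r. H (z * s2 / D r) (r * D r) (z * s1 / D r))"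
      using D by (intro continuous_on_H continuous_on_divide continuous_on_mult continuous_on_const continuous_on_id)
        (auto simp: less_le)
    show "Ea (0 * s1) \<cdot> Eb z \<cdot> Ea (0 * s2) = H (z * s2 / D 0) (0 * D 0) (z * s1 / D 0)"
    proof -
      have "z * s2 / D 0 + z * s1 / D 0 = z"
        using assms(3) by (simp add: D_def add_divide_distrib[symmetric] distrib_left[symmetric] add.commute)
      then show ?thesis by (simp add: H_0)
    qed
    fix r :: real assume "0 \<le> r" "r \<le> 1"
    define d where "d = D r"
    have d: "d > 0" "s1 + s2 + r * (z * s1 * s2) = d"
      using D[OF \<open>0 \<le> r\<close> \<open>r \<le> 1\<close>] by (simp_all add: d_def D_def)
    have "z * s2 / d + z * s1 / d + z * s2 / d * (r * d) * (z * s1 / d) = z * (s1 + s2 + r * (z * s1 * s2)) / d"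
      using d(1) by (simp add: field_simps)
    then have "z * s2 / d + z * s1 / d + z * s2 / d * (r * d) * (z * s1 / d) = z"
      using d by simp
    moreover have "r * s1 + (1 + r * s1 * z) * (r * s2) = r * d"
      by (simp add: d(2)[symmetric] algebra_simps)
    ultimately show "p (Ea (r * s1) \<cdot> Eb z \<cdot> Ea (r * s2)) = p (H (z * s2 / D r) (r * D r) (z * s1 / D r))"
      unfolding d_def[symmetric] using d(1)
      by (simp add: p_H p_mul p_E mat22_arith) (simp add: algebra_simps)
  qed simp
  moreover have "D 1 = \<Gamma>" by (simp add: D_def \<Gamma>)
  ultimately show ?thesis by simp
qed

end

section \<open>Exact reachability of all elements over matrices with positive lower left
  entry\<close>

lemma exists_in_at_right_0:
  assumes "\<forall>\<^sub>F x in at_right (0::real). P x"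
  obtains x where "x > 0" "P x"
proof -
  have "\<forall>\<^sub>F x in at_right (0::real). P x \<and> x > 0"
    using assms eventually_at_right_less by (rule eventually_conj)
  from eventually_happens'[OF _ this] show ?thesis using that by auto
qed

context sl2_cover
begin

text \<open>The element \<open>H x s y\<close> lying over the matrix with diagonal \<open>\<alpha>, \<delta>\<close> and lower left entry \<open>\<gamma> \<noteq> 0\<close>.\<close>

definition lift22 :: "real \<Rightarrow> real \<Rightarrow> real \<Rightarrow> 'g" where
  "lift22 \<alpha> \<gamma> \<delta> = H ((\<alpha> - 1) / \<gamma>) \<gamma> ((\<delta> - 1) / \<gamma>)"

lemma p_lift22: "\<gamma> \<noteq> 0 \<Longrightarrow> p (lift22 \<alpha> \<gamma> \<delta>) = mat22 \<alpha> ((\<alpha> * \<delta> - 1) / \<gamma>) \<gamma> \<delta>"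
  by (simp add: lift22_def p_H field_simps)

text \<open>Matrix multiplication lifts without a kernel correction when the lower left entries of
  both factors and of the product are positive: the inner powers of \<open>Eb\<close> merge, and
  \<open>Ea_Eb_Ea\<close> reorders the middle.\<close>

lemma lift22_mul:
  assumes pos: "\<gamma> > 0" "\<gamma>' > 0" "\<gamma>'' > 0"
    and prod: "\<alpha>'' = \<alpha> * \<alpha>' + \<beta> * \<gamma>'" "\<gamma>'' = \<gamma> * \<alpha>' + \<delta> * \<gamma>'" "\<delta>'' = \<gamma> * \<beta>' + \<delta> * \<delta>'"
    and det: "\<alpha> * \<delta> - \<beta> * \<gamma> = 1" "\<alpha>' * \<delta>' - \<beta>' * \<gamma>' = 1"
  shows "lift22 \<alpha> \<gamma> \<delta> \<cdot> lift22 \<alpha>' \<gamma>' \<delta>' = lift22 \<alpha>'' \<gamma>'' \<delta>''"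
proof -
  define x y x' y' z where "x = (\<alpha> - 1) / \<gamma>" and "y = (\<delta> - 1) / \<gamma>"
    and "x' = (\<alpha>' - 1) / \<gamma>'" and "y' = (\<delta>' - 1) / \<gamma>'" and "z = y + x'"
  have \<Gamma>: "\<gamma>'' = \<gamma> + \<gamma>' + z * \<gamma> * \<gamma>'"
    using pos(1,2) by (simp add: prod z_def y_def x'_def field_simps)
  have x'': "(\<alpha>'' - 1) / \<gamma>'' = x + z * \<gamma>' / \<gamma>''"
  proof -
    have \<beta>: "\<beta> = (\<alpha> * \<delta> - 1) / \<gamma>" using det(1) pos(1) by (simp add: field_simps)
    have "\<alpha>'' - 1 = x * \<gamma>'' + z * \<gamma>'"
      using pos(1,2) by (simp add: prod z_def y_def x_def x'_def \<beta> field_simps)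
    then show ?thesis using pos(3) by (simp add: field_simps)
  qed
  have y'': "(\<delta>'' - 1) / \<gamma>'' = z * \<gamma> / \<gamma>'' + y'"
  proof -
    have \<beta>: "\<beta>' = (\<alpha>' * \<delta>' - 1) / \<gamma>'" using det(2) pos(2) by (simp add: field_simps)
    have "\<delta>'' - 1 = z * \<gamma> + y' * \<gamma>''"
      using pos(1,2) by (simp add: prod z_def y_def y'_def x'_def \<beta> field_simps)
    then show ?thesis using pos(3) by (simp add: field_simps)
  qed
  have "lift22 \<alpha> \<gamma> \<delta> \<cdot> lift22 \<alpha>' \<gamma>' \<delta>' = Eb x \<cdot> (Ea \<gamma> \<cdot> Eb z \<cdot> Ea \<gamma>') \<cdot> Eb y'"
    by (simp add: lift22_def H_def x_def y_def x'_def y'_def z_def Eb_add mul_assoc)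
  also have "Ea \<gamma> \<cdot> Eb z \<cdot> Ea \<gamma>' = H (z * \<gamma>' / \<gamma>'') \<gamma>'' (z * \<gamma> / \<gamma>'')"
    using pos \<Gamma> by (intro Ea_Eb_Ea) auto
  also have "Eb x \<cdot> \<dots> \<cdot> Eb y' = lift22 \<alpha>'' \<gamma>'' \<delta>''"
    by (simp add: lift22_def H_def x'' y'' Eb_add mul_assoc)
  finally show ?thesis .
qed

lemma reach_lift22_symmetric:
  assumes "s > 0" "c \<ge> 1 / 2" "2 * s \<le> T" shows "reach T (lift22 c s c)"
  unfolding lift22_def using assms by (intro reach_H_symmetric) auto

lemma reach_lift22_hyperbolic:
  assumes "s > 0" "c \<ge> 1" "T > 0" "2 * s\<^sup>2 \<le> T\<^sup>2 * (c + 1)" shows "reach T (lift22 c s c)"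
  unfolding lift22_def using assms by (intro reach_H_hyperbolic) (auto simp: add.commute)

text \<open>The last factor is chosen so that the remaining left factor has equal diagonal entries,
  hence is a single piece of the control; \<open>\<epsilon> \<rightarrow> 0\<close> makes the duration of the last factor negligible.\<close>

lemma reach_lift22_large_trace:
  assumes \<gamma>: "\<gamma> > 0" and \<alpha>: "\<alpha> > 1" and tr: "\<alpha> + \<delta> > 2"
    and T: "T > 0" "2 * \<gamma>\<^sup>2 < T\<^sup>2 * (\<alpha> + 1)" and "\<eta> > 0"
  shows "reach (T + \<eta>) (lift22 \<alpha> \<gamma> \<delta>)"
proof -
  define \<beta> where "\<beta> = (\<alpha> * \<delta> - 1) / \<gamma>"
  have det: "\<alpha> * \<delta> - \<beta> * \<gamma> = 1" using \<gamma> by (simp add: \<beta>_def)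
  have tr2: "(\<alpha> + \<delta>)\<^sup>2 - 4 > 0"
    using power_strict_mono[OF tr, of 2] by simp
  \<comment> \<open>Equality of the diagonal entries of the left factor amounts to \<open>2 *
    \<gamma> * x - (\<delta> - \<alpha>) = s * (\<beta> + (\<delta> - \<alpha>) * x - \<gamma> * x *
    x)\<close>. Both sides are set to \<open>\<epsilon>\<close> and solved, first for
    \<open>x\<close>, then for \<open>s\<close>; trace above 2 makes the denominator of
    \<open>s\<close> positive for small \<open>\<epsilon>\<close>.\<close>
  define x where "x \<epsilon> = (\<delta> - \<alpha> + \<epsilon>) / (2 * \<gamma>)" for \<epsilon>
  define s where "s \<epsilon> = 4 * \<gamma> * \<epsilon> / ((\<alpha> + \<delta>)\<^sup>2 - 4 - \<epsilon>\<^sup>2)" for \<epsilon>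
  define c where "c \<epsilon> = 1 + x \<epsilon> * s \<epsilon>" for \<epsilon>
  define \<kappa> where "\<kappa> \<epsilon> = \<alpha> * c \<epsilon> - \<beta> * s \<epsilon>" for \<epsilon>
  define \<gamma>' where "\<gamma>' \<epsilon> = \<gamma> * c \<epsilon> - \<delta> * s \<epsilon>" for \<epsilon>
  \<comment> \<open>As \<open>\<epsilon>\<close> tends to 0 the right factor takes vanishing time,
    while \<open>\<kappa>\<close> and \<open>\<gamma>'\<close> tend to \<open>\<alpha>\<close> and
    \<open>\<gamma>\<close>. The strict hypotheses therefore hold for the left factor once
    \<open>\<epsilon>\<close> is small.\<close>
  have s_lim: "(s \<longlongrightarrow> 4 * \<gamma> * 0 / ((\<alpha> + \<delta>)\<^sup>2 - 4 - 0\<^sup>2)) (at_right 0)"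
    unfolding s_def using tr2 by (intro tendsto_intros) auto
  have x_lim: "(x \<longlongrightarrow> (\<delta> - \<alpha> + 0) / (2 * \<gamma>)) (at_right 0)"
    unfolding x_def using \<gamma> by (intro tendsto_intros) auto
  have c_lim: "(c \<longlongrightarrow> 1) (at_right 0)"
    unfolding c_def using tendsto_add[OF tendsto_const tendsto_mult[OF x_lim s_lim], of 1] by simp
  have \<kappa>_lim: "(\<kappa> \<longlongrightarrow> \<alpha>) (at_right 0)"
    unfolding \<kappa>_def using tendsto_diff[OF tendsto_mult[OF tendsto_const c_lim] tendsto_mult[OF tendsto_const s_lim], of \<alpha> \<beta>] by simp
  have \<gamma>'_lim: "(\<gamma>' \<longlongrightarrow> \<gamma>) (at_right 0)"
    unfolding \<gamma>'_def using tendsto_diff[OF tendsto_mult[OF tendsto_const c_lim] tendsto_mult[OF tendsto_const s_lim], of \<gamma> \<delta>] by simp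
  have d_lim: "((\<lambda>\<epsilon>. (\<alpha> + \<delta>)\<^sup>2 - 4 - \<epsilon>\<^sup>2) \<longlongrightarrow> (\<alpha> + \<delta>)\<^sup>2 - 4 - 0\<^sup>2) (at_right 0)"
    by (intro tendsto_intros)
  have T_lim: "((\<lambda>\<epsilon>. 2 * (\<gamma>' \<epsilon>)\<^sup>2 - T\<^sup>2 * (\<kappa> \<epsilon> + 1)) \<longlongrightarrow> 2 * \<gamma>\<^sup>2 - T\<^sup>2 * (\<alpha> + 1)) (at_right 0)"
    by (intro tendsto_intros \<gamma>'_lim \<kappa>_lim)
  have "\<forall>\<^sub>F \<epsilon> in at_right 0. s \<epsilon> < \<eta> / 2"
    using order_tendstoD(2)[OF s_lim, of "\<eta> / 2"] \<open>\<eta> > 0\<close> by simp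
  moreover have "\<forall>\<^sub>F \<epsilon> in at_right 0. 1 / 2 < c \<epsilon>"
    using order_tendstoD(1)[OF c_lim, of "1 / 2"] by simp
  moreover have "\<forall>\<^sub>F \<epsilon> in at_right 0. 1 < \<kappa> \<epsilon>"
    using order_tendstoD(1)[OF \<kappa>_lim \<alpha>] .
  moreover have "\<forall>\<^sub>F \<epsilon> in at_right 0. 0 < \<gamma>' \<epsilon>"
    using order_tendstoD(1)[OF \<gamma>'_lim \<gamma>] .
  moreover have "\<forall>\<^sub>F \<epsilon> in at_right 0. 0 < (\<alpha> + \<delta>)\<^sup>2 - 4 - \<epsilon>\<^sup>2"
    using order_tendstoD(1)[OF d_lim, of 0] tr2 by simp
  moreover have "\<forall>\<^sub>F \<epsilon> in at_right 0. 2 * (\<gamma>' \<epsilon>)\<^sup>2 - T\<^sup>2 * (\<kappa> \<epsilon> + 1) < 0"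
    using order_tendstoD(2)[OF T_lim, of 0] T(2) by simp
  ultimately have "\<forall>\<^sub>F \<epsilon> in at_right 0. s \<epsilon> < \<eta> / 2 \<and> 1 / 2 < c \<epsilon> \<and> 1 < \<kappa> \<epsilon> \<and> 0 < \<gamma>' \<epsilon> \<and>
      0 < (\<alpha> + \<delta>)\<^sup>2 - 4 - \<epsilon>\<^sup>2 \<and> 2 * (\<gamma>' \<epsilon>)\<^sup>2 - T\<^sup>2 * (\<kappa> \<epsilon> + 1) < 0"
    by (intro eventually_conj)
  from exists_in_at_right_0[OF this] obtain \<epsilon> where \<epsilon>: "\<epsilon> > 0" "s \<epsilon> < \<eta> / 2" "1 / 2 < c \<epsilon>" "1 < \<kappa> \<epsilon>"
     "0 < \<gamma>' \<epsilon>" "0 < (\<alpha> + \<delta>)\<^sup>2 - 4 - \<epsilon>\<^sup>2" "2 * (\<gamma>' \<epsilon>)\<^sup>2 - T\<^sup>2 * (\<kappa> \<epsilon> + 1) < 0"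
    by blast
  define s' c' x' \<kappa>' g where "s' = s \<epsilon>" and "c' = c \<epsilon>" and "x' = x \<epsilon>" and "\<kappa>' = \<kappa> \<epsilon>" and "g = \<gamma>' \<epsilon>"
  have s': "s' > 0" using \<epsilon> \<gamma> by (simp add: s'_def s_def)
  \<comment> \<open>The upper right entry of the right factor.\<close>
  define v where "v = x' * (2 + x' * s')"
  have c': "c' * c' = 1 + v * s'" by (simp add: v_def c'_def c_def s'_def x'_def algebra_simps)
  have sym: "\<gamma> * v = (\<delta> - \<alpha>) * c' + \<beta> * s'"
  proof -
    have "\<beta> + (\<delta> - \<alpha>) * x' - \<gamma> * x' * x' = ((\<alpha> + \<delta>)\<^sup>2 - 4 - \<epsilon>\<^sup>2) / (4 * \<gamma>)"
      using \<gamma> by (simp add: \<beta>_def x'_def x_def field_simps power2_eq_square)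
    then have "s' * (\<beta> + (\<delta> - \<alpha>) * x' - \<gamma> * x' * x') = \<epsilon>"
      using \<epsilon>(6) \<gamma> by (simp add: s'_def s_def)
    moreover have "2 * \<gamma> * x' = \<delta> - \<alpha> + \<epsilon>" using \<gamma> by (simp add: x'_def x_def)
    ultimately show ?thesis
      unfolding v_def c'_def c_def x'_def[symmetric] s'_def[symmetric] by (simp add: algebra_simps)
  qed
  have \<kappa>1: "\<kappa>' = \<alpha> * c' - \<beta> * s'" by (simp add: \<kappa>'_def \<kappa>_def c'_def s'_def)
  have \<kappa>2: "\<kappa>' = \<delta> * c' - \<gamma> * v" unfolding \<kappa>1 sym by (simp add: algebra_simps)
  have g: "g = \<gamma> * c' - \<delta> * s'" by (simp add: g_def \<gamma>'_def c'_def s'_def)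
  \<comment> \<open>The upper right entry of the left factor; its diagonal entries agree by
    \<open>\<kappa>1\<close> and \<open>\<kappa>2\<close>.\<close>
  define b where "b = \<beta> * c' - \<alpha> * v"
  have detK: "\<kappa>' * \<kappa>' - b * g = 1"
  proof -
    have "\<kappa>' * \<kappa>' - b * g = (\<alpha> * c' - \<beta> * s') * (\<delta> * c' - \<gamma> * v) - b * g"
      using \<kappa>1 \<kappa>2 by simp
    also have "\<dots> = (\<alpha> * \<delta> - \<beta> * \<gamma>) * (c' * c' - v * s')"
      by (simp add: b_def g algebra_simps)
    finally show ?thesis using det c' by simp
  qed
  have "lift22 \<kappa>' g \<kappa>' \<cdot> lift22 c' s' c' = lift22 \<alpha> \<gamma> \<delta>"
  proof (rule lift22_mul[where \<beta> = b and \<beta>' = v])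
    have "\<kappa>' * c' + b * s' = \<alpha> * (c' * c' - v * s')" by (simp add: \<kappa>1 b_def algebra_simps)
    then show "\<alpha> = \<kappa>' * c' + b * s'" using c' by simp
    have "g * c' + \<kappa>' * s' = \<gamma> * (c' * c' - v * s')" by (simp add: \<kappa>2 g algebra_simps)
    then show "\<gamma> = g * c' + \<kappa>' * s'" using c' by simp
    have "g * v + \<kappa>' * c' = \<delta> * (c' * c' - v * s')" by (simp add: \<kappa>2 g algebra_simps)
    then show "\<delta> = g * v + \<kappa>' * c'" using c' by simp
  qed (use \<epsilon> s' \<gamma> detK c' in \<open>auto simp: g_def\<close>)
  moreover have "reach T (lift22 \<kappa>' g \<kappa>')"
    using \<epsilon> T by (intro reach_lift22_hyperbolic) (auto simp: \<kappa>'_def g_def)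
  moreover have "reach \<eta> (lift22 c' s' c')"
    using \<epsilon> s' by (intro reach_lift22_symmetric) (auto simp: c'_def s'_def)
  ultimately show ?thesis using reach_mul by metis
qed

text \<open>A short first piece close to \<open>exp (- 2 L b)\<close> leaves a factor of large trace, which is
  reached quickly.\<close>

lemma reach_lift22:
  assumes \<gamma>: "\<gamma> > 0" and T: "T > 0"
  shows "reach T (lift22 \<alpha> \<gamma> \<delta>)"
proof -
  define \<tau> where "\<tau> = T / 4"
  have \<tau>: "\<tau> > 0" using T by (simp add: \<tau>_def)
  \<comment> \<open>The time condition for the remaining factor says that its upper left entry plus
    1 exceeds \<open>Q\<close>. In the limit that entry is
    \<open>\<alpha> + 2 * (L * \<gamma>)\<close>, and \<open>L\<close> makes it large enough for
    this and for both bounds of \<open>reach_lift22_large_trace\<close>.\<close>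
  define Q where "Q = 2 * \<gamma>\<^sup>2 / \<tau>\<^sup>2"
  define L where "L = (2 + \<bar>\<alpha>\<bar> + \<bar>\<delta>\<bar> + Q) / \<gamma>"
  have L\<gamma>: "L * \<gamma> = 2 + \<bar>\<alpha>\<bar> + \<bar>\<delta>\<bar> + Q" using \<gamma> by (simp add: L_def)
  have "Q \<ge> 0" by (simp add: Q_def)
  then have L1: "\<alpha> + 2 * (L * \<gamma>) > 1" and L2: "\<alpha> + 2 * (L * \<gamma>) + \<delta> > 2"
    and L3': "Q < \<alpha> + 2 * (L * \<gamma>) + 1"
    unfolding L\<gamma> by (auto simp: abs_if)
  from L3' have L3: "2 * \<gamma>\<^sup>2 < \<tau>\<^sup>2 * (\<alpha> + 2 * (L * \<gamma>) + 1)"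
    using \<tau> by (simp add: Q_def divide_less_eq mult.commute)
  define \<beta> where "\<beta> = (\<alpha> * \<delta> - 1) / \<gamma>"
  have det: "\<alpha> * \<delta> - \<beta> * \<gamma> = 1" using \<gamma> by (simp add: \<beta>_def)
  \<comment> \<open>The first piece has parameters \<open>x = - L\<close> and \<open>s\<close>, with
    equal diagonal entries \<open>c s\<close>; \<open>\<alpha>1\<close>, \<open>\<gamma>1\<close>,
    \<open>\<delta>1\<close> are entries of its inverse times the target matrix.\<close>
  define c where "c s = 1 - L * s" for s
  define \<alpha>1 where "\<alpha>1 s = \<alpha> * c s + L * \<gamma> * (2 - L * s)" for s
  define \<gamma>1 where "\<gamma>1 s = \<gamma> * c s - \<alpha> * s" for s
  define \<delta>1 where "\<delta>1 s = \<delta> * c s - \<beta> * s" for s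
  have c_lim: "(c \<longlongrightarrow> 1 - L * 0) (at_right 0)"
    unfolding c_def by (intro tendsto_intros)
  have \<alpha>_lim: "(\<alpha>1 \<longlongrightarrow> \<alpha> * (1 - L * 0) + L * \<gamma> * (2 - L * 0)) (at_right 0)"
    unfolding \<alpha>1_def by (intro tendsto_intros c_lim)
  have \<gamma>_lim: "(\<gamma>1 \<longlongrightarrow> \<gamma> * (1 - L * 0) - \<alpha> * 0) (at_right 0)"
    unfolding \<gamma>1_def by (intro tendsto_intros c_lim)
  have \<delta>_lim: "(\<delta>1 \<longlongrightarrow> \<delta> * (1 - L * 0) - \<beta> * 0) (at_right 0)"
    unfolding \<delta>1_def by (intro tendsto_intros c_lim)
  have tr_lim: "((\<lambda>s. \<alpha>1 s + \<delta>1 s) \<longlongrightarrow> \<alpha> + 2 * (L * \<gamma>) + \<delta>) (at_right 0)"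
    using tendsto_add[OF \<alpha>_lim \<delta>_lim] by (simp add: mult.commute)
  have T_lim: "((\<lambda>s. 2 * (\<gamma>1 s)\<^sup>2 - \<tau>\<^sup>2 * (\<alpha>1 s + 1)) \<longlongrightarrow>
      2 * (\<gamma> * (1 - L * 0) - \<alpha> * 0)\<^sup>2 - \<tau>\<^sup>2 * (\<alpha> * (1 - L * 0) + L * \<gamma> * (2 - L * 0) + 1)) (at_right 0)"
    by (intro tendsto_intros \<gamma>_lim \<alpha>_lim)
  have id_lim: "((\<lambda>s. s) \<longlongrightarrow> 0) (at_right (0::real))" by (rule tendsto_ident_at)
  have "\<forall>\<^sub>F s in at_right 0. s < \<tau> / 2"
    using order_tendstoD(2)[OF id_lim, of "\<tau> / 2"] \<tau> by simp
  moreover have "\<forall>\<^sub>F s in at_right 0. 1 / 2 < c s"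
    using order_tendstoD(1)[OF c_lim, of "1 / 2"] by simp
  moreover have "\<forall>\<^sub>F s in at_right 0. 1 < \<alpha>1 s"
    using order_tendstoD(1)[OF \<alpha>_lim, of 1] L1 by (simp add: mult.commute)
  moreover have "\<forall>\<^sub>F s in at_right 0. 0 < \<gamma>1 s"
    using order_tendstoD(1)[OF \<gamma>_lim, of 0] \<gamma> by simp
  moreover have "\<forall>\<^sub>F s in at_right 0. 2 < \<alpha>1 s + \<delta>1 s"
    using order_tendstoD(1)[OF tr_lim L2] .
  moreover have "\<forall>\<^sub>F s in at_right 0. 2 * (\<gamma>1 s)\<^sup>2 - \<tau>\<^sup>2 * (\<alpha>1 s + 1) < 0"
    using order_tendstoD(2)[OF T_lim, of 0] L3 by (simp add: mult.commute)
  ultimately have "\<forall>\<^sub>F s in at_right 0. s < \<tau> / 2 \<and> 1 / 2 < c s \<and> 1 < \<alpha>1 s \<and> 0 < \<gamma>1 s \<and>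
      2 < \<alpha>1 s + \<delta>1 s \<and> 2 * (\<gamma>1 s)\<^sup>2 - \<tau>\<^sup>2 * (\<alpha>1 s + 1) < 0"
    by (intro eventually_conj)
  from exists_in_at_right_0[OF this] obtain s where s: "s > 0" "s < \<tau> / 2" "1 / 2 < c s" "1 < \<alpha>1 s"
      "0 < \<gamma>1 s" "2 < \<alpha>1 s + \<delta>1 s" "2 * (\<gamma>1 s)\<^sup>2 - \<tau>\<^sup>2 * (\<alpha>1 s + 1) < 0"
    by blast
  define c' v where "c' = c s" and "v = - L * (2 - L * s)"
  have c': "c' * c' = 1 + v * s" by (simp add: c'_def c_def v_def algebra_simps)
  have \<alpha>1: "\<alpha>1 s = \<alpha> * c' - \<gamma> * v" and \<gamma>1: "\<gamma>1 s = \<gamma> * c' - \<alpha> * s" and \<delta>1: "\<delta>1 s = \<delta> * c' - \<beta> * s"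
    by (simp_all add: \<alpha>1_def \<gamma>1_def \<delta>1_def c'_def v_def algebra_simps)
  define \<beta>1 where "\<beta>1 = \<beta> * c' - \<delta> * v"
  have "lift22 c' s c' \<cdot> lift22 (\<alpha>1 s) (\<gamma>1 s) (\<delta>1 s) = lift22 \<alpha> \<gamma> \<delta>"
  proof (rule lift22_mul[where \<beta> = v and \<beta>' = \<beta>1])
    have "c' * \<alpha>1 s + v * \<gamma>1 s = \<alpha> * (c' * c' - v * s)" by (simp add: \<alpha>1 \<gamma>1 algebra_simps)
    then show "\<alpha> = c' * \<alpha>1 s + v * \<gamma>1 s" using c' by simp
    have "s * \<alpha>1 s + c' * \<gamma>1 s = \<gamma> * (c' * c' - v * s)" by (simp add: \<alpha>1 \<gamma>1 algebra_simps)
    then show "\<gamma> = s * \<alpha>1 s + c' * \<gamma>1 s" using c' by simp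
    have "s * \<beta>1 + c' * \<delta>1 s = \<delta> * (c' * c' - v * s)" by (simp add: \<beta>1_def \<delta>1 algebra_simps)
    then show "\<delta> = s * \<beta>1 + c' * \<delta>1 s" using c' by simp
    have "\<alpha>1 s * \<delta>1 s - \<beta>1 * \<gamma>1 s = (\<alpha> * \<delta> - \<beta> * \<gamma>) * (c' * c' - v * s)"
      by (simp add: \<alpha>1 \<beta>1_def \<gamma>1 \<delta>1 algebra_simps)
    then show "\<alpha>1 s * \<delta>1 s - \<beta>1 * \<gamma>1 s = 1" using det c' by simp
  qed (use s \<gamma> c' in auto)
  moreover have "reach \<tau> (lift22 c' s c')"
    using s by (intro reach_lift22_symmetric) (auto simp: c'_def)
  moreover have "reach (\<tau> + \<tau>) (lift22 (\<alpha>1 s) (\<gamma>1 s) (\<delta>1 s))"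
    using s \<tau> by (intro reach_lift22_large_trace) auto
  ultimately have "reach (\<tau> + (\<tau> + \<tau>)) (lift22 \<alpha> \<gamma> \<delta>)" using reach_mul by metis
  then show ?thesis using \<tau> by (rule_tac reach_mono) (auto simp: \<tau>_def)
qed

section \<open>The small-time reachable set and its closure\<close>

abbreviation "Ast0 \<equiv> Ast mul e p A0 B0"

lemma lift22_in_Ast: "\<gamma> > 0 \<Longrightarrow> lift22 \<alpha> \<gamma> \<delta> \<in> Ast0"
  by (simp add: Ast_iff_reach reach_lift22)

lemma H_in_Ast: "s > 0 \<Longrightarrow> H x s y \<in> Ast0"
  using lift22_in_Ast[of s "1 + x * s" "1 + y * s"] by (simp add: lift22_def)

lemma e_in_Ast: "e \<in> Ast0"
proof -
  have "reach T e" if "T > 0" for T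
    unfolding reach_def using that by (intro exI[of _ "[]"]) (simp add: admissible_def duration_def endpoint_def)
  then show ?thesis by (simp add: Ast_iff_reach)
qed

lemma mul_in_Ast: "x \<in> Ast0 \<Longrightarrow> y \<in> Ast0 \<Longrightarrow> x \<cdot> y \<in> Ast0"
  unfolding Ast_iff_reach by (metis field_sum_of_halves half_gt_zero reach_mul)

text \<open>The control \<open>-1\<close> produces rotations. Below angle \<open>pi\<close> they
  have the form \<open>H x s y\<close> with \<open>s\<close> a positive sine; larger angles are
  products of rotations by at most 1.\<close>

lemma Er_in_Ast:
  assumes "t \<ge> 0" shows "Er t \<in> Ast0"
proof -
  have small: "Er t \<in> Ast0" if "0 \<le> t" "t \<le> 1" for t
  proof (cases "t = 0")
    case False
    have "t < pi" using that pi_gt3 by simp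
    have "cosh_root (- 1) \<tau> > - 1" if "0 \<le> \<tau>" "\<tau> \<le> t" for \<tau>
      using that \<open>t < pi\<close> cos_monotone_0_pi[of \<tau> pi] by (simp add: cosh_root_def)
    then have "gexp (A0 + (- 1) *\<^sub>R B0) t = H (- 1 * sinh_root (- 1) t / (1 + cosh_root (- 1) t)) (sinh_root (- 1) t) (- 1 * sinh_root (- 1) t / (1 + cosh_root (- 1) t))"
      using that by (intro gexp_control_eq_H) auto
    moreover have "sinh_root (- 1) t > 0"
      using that False \<open>t < pi\<close> sin_gt_zero by (simp add: sinh_root_def)
    ultimately show ?thesis using H_in_Ast by simp
  qed (simp add: e_in_Ast)
  have "\<forall>t. 0 \<le> t \<and> t \<le> real n \<longrightarrow> Er t \<in> Ast0" for n
  proof (induction n)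
    case (Suc n)
    show ?case
    proof (intro allI impI)
      fix t assume t: "0 \<le> t \<and> t \<le> real (Suc n)"
      show "Er t \<in> Ast0"
      proof (cases "t \<le> 1")
        case False
        then have "Er (t - 1) \<in> Ast0" using Suc t by simp
        then have "Er (t - 1) \<cdot> Er 1 \<in> Ast0" using small[of 1] by (intro mul_in_Ast) simp_all
        then show ?thesis unfolding Er_add[symmetric] by simp
      qed (use small t in simp)
    qed
  qed (auto simp: e_in_Ast dest: order_antisym)
  then show ?thesis using assms real_arch_simple[of t] by blast
qed

lemma limit_in_closure:
  fixes f :: "real \<Rightarrow> 'g"
  assumes "continuous_on UNIV f" "\<And>s. s > 0 \<Longrightarrow> f s \<in> S"
  shows "f 0 \<in> closure S"
proof -
  have "f ` closure {0<..} \<subseteq> closure S"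
    using assms by (intro image_closure_subset) (auto intro: continuous_on_subset closure_subset[THEN subsetD])
  then show ?thesis by auto
qed

lemma Eb_in_closure: "Eb v \<in> closure Ast0"
proof -
  have "continuous_on UNIV (\<lambda>s. H v s 0)" by (intro continuous_intros)
  from limit_in_closure[OF this H_in_Ast] show ?thesis by (simp add: H_0)
qed

text \<open>The factor \<open>exp v\<close> keeps the lower left entry equal to \<open>s\<close> for
  all \<open>v\<close>, so both sides lift the same curve in \<open>v\<close>, starting from
  \<open>Ea s\<close>. Letting \<open>s\<close> tend to 0 then puts \<open>Ec v\<close> in the
  closure.\<close>

lemma Ec_Ea_eq_lift22:
  assumes "s > 0" shows "Ec v \<cdot> Ea (s * exp v) = lift22 (exp v) s (exp (- v))"
proof (rule lift_eq[of UNIV "\<lambda>v. Ec v \<cdot> Ea (s * exp v)" "\<lambda>v. lift22 (exp v) s (exp (- v))" 0])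
  show "continuous_on UNIV (\<lambda>v. Ec v \<cdot> Ea (s * exp v))"
    by (intro continuous_on_mul continuous_on_E continuous_intros)
  show "continuous_on UNIV (\<lambda>v. lift22 (exp v) s (exp (- v)))"
    unfolding lift22_def using assms by (intro continuous_on_H continuous_intros) auto
  show "p (Ec v \<cdot> Ea (s * exp v)) = p (lift22 (exp v) s (exp (- v)))" for v
    using assms by (simp add: p_mul p_E p_lift22 mat22_arith exp_minus)
qed (simp_all add: lift22_def H_def)

lemma Ec_in_closure: "Ec v \<in> closure Ast0"
proof -
  have "continuous_on UNIV (\<lambda>s. Ec v \<cdot> Ea (s * exp v))"
    by (intro continuous_on_mul continuous_on_E continuous_intros)
  moreover have "Ec v \<cdot> Ea (s * exp v) \<in> Ast0" if "s > 0" for s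
    using that by (simp add: Ec_Ea_eq_lift22 lift22_in_Ast)
  ultimately show ?thesis
    using limit_in_closure[of "\<lambda>s. Ec v \<cdot> Ea (s * exp v)" Ast0] by simp
qed

subsection \<open>The kernel of the covering\<close>

lemma p_cases:
  obtains \<alpha> \<beta> \<gamma> \<delta> where "p g = mat22 \<alpha> \<beta> \<gamma> \<delta>" "\<alpha> * \<delta> - \<beta> * \<gamma> = 1"
  using that[OF mat22_eta[symmetric]] p_in_SL2[of g] by (simp add: SL2_def det_2)

section \<open>Path connectedness of the covering group\<close>

definition joined :: "'g \<Rightarrow> bool" where
  "joined g \<longleftrightarrow> (\<exists>f. continuous_on {0..1::real} f \<and> f 0 = e \<and> f 1 = g)"

lemma joined_mul: "joined x \<Longrightarrow> joined y \<Longrightarrow> joined (x \<cdot> y)"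
  unfolding joined_def
proof (elim exE conjE)
  fix f g assume "continuous_on {0..1::real} f" "f 0 = e" "f 1 = x" "continuous_on {0..1::real} g" "g 0 = e" "g 1 = y"
  then show "\<exists>h. continuous_on {0..1::real} h \<and> h 0 = e \<and> h 1 = x \<cdot> y"
    by (intro exI[of _ "\<lambda>t. f t \<cdot> g t"]) (auto intro: continuous_on_mul)
qed

lemma joined_ginv: "joined x \<Longrightarrow> joined (ginv x)"
  unfolding joined_def
proof (elim exE conjE)
  fix f assume "continuous_on {0..1::real} f" "f 0 = e" "f 1 = x"
  moreover have "ginv e = e" using mul_ginv(1)[of e] unfolding mul_e(2) .
  ultimately show "\<exists>h. continuous_on {0..1::real} h \<and> h 0 = e \<and> h 1 = ginv x"
    by (intro exI[of _ "\<lambda>t. ginv (f t)"]) (auto intro: continuous_on_ginv)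
qed

lemma joined_gexp: "X \<in> sl2 \<Longrightarrow> joined (gexp X t)"
  unfolding joined_def
  by (intro exI[of _ "\<lambda>s. gexp X (s * t)"]) (auto intro!: continuous_on_gexp continuous_intros)

text \<open>Near \<open>e\<close> every element is a product of one-parameter subgroups, by
  factoring its matrix into lower triangular, diagonal and upper triangular parts.\<close>

lemma nhd_e_joined:
  obtains N where "open N" "e \<in> N" "\<And>g. g \<in> N \<Longrightarrow> joined g"
proof -
  have "\<exists>V W q. e \<in> V \<and> open V \<and> homeomorphism V W p q"
    by (rule covering_space_local_homeomorphism[OF covering UNIV_I[of e]]) auto
  then obtain V W q where V: "e \<in> V" "open V" "homeomorphism V W p q" by blast
  have inj: "inj_on p V" by (rule inj_on_inverseI[of V q]) (use V(3) in \<open>simp add: homeomorphism_def\<close>)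
  define \<Psi> where "\<Psi> M = Ea (M $ 2 $ 1 / M $ 1 $ 1) \<cdot> Ec (ln (M $ 1 $ 1)) \<cdot> Eb (M $ 1 $ 2 / M $ 1 $ 1)" for M :: "real^2^2"
  define U where "U = {g. p g $ 1 $ 1 > 0}"
  have p_cont: "continuous_on UNIV (\<lambda>g. p g $ i $ j)" for i j
    by (intro continuous_on_component continuous_on_p continuous_on_id)
  have "open U" unfolding U_def
    using open_Collect_less[OF continuous_on_const[of UNIV 0] p_cont[of 1 1]] .
  have "continuous_on U (\<lambda>g. \<Psi> (p g))"
    unfolding \<Psi>_def
    by (intro continuous_on_mul continuous_on_E continuous_on_divide continuous_on_ln
          p_cont[THEN continuous_on_subset, OF subset_UNIV]) (auto simp: U_def)
  then have "open (U \<inter> (\<lambda>g. \<Psi> (p g)) -` V)"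
    using \<open>open U\<close> \<open>open V\<close> by (rule continuous_open_preimage)
  then have "open (V \<inter> (U \<inter> (\<lambda>g. \<Psi> (p g)) -` V))" by (rule open_Int[OF V(2)])
  moreover have "e \<in> V \<inter> (U \<inter> (\<lambda>g. \<Psi> (p g)) -` V)"
    using V by (simp add: U_def \<Psi>_def mat22_arith)
  moreover have "joined g" if g: "g \<in> V \<inter> (U \<inter> (\<lambda>g. \<Psi> (p g)) -` V)" for g
  proof -
    obtain \<alpha> \<beta> \<gamma> \<delta> where M: "p g = mat22 \<alpha> \<beta> \<gamma> \<delta>" "\<alpha> * \<delta> - \<beta> * \<gamma> = 1" by (rule p_cases)
    have \<alpha>: "\<alpha> > 0" using g M by (simp add: U_def)
    then have "\<gamma> * (\<beta> / \<alpha>) + inverse \<alpha> = \<delta>" using M(2) by (simp add: field_simps)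
    then have "p (\<Psi> (p g)) = p g"
      using \<alpha> unfolding \<Psi>_def M mat22_nth p_mul p_E by (simp add: mat22_arith exp_minus)
    \<comment> \<open>Both elements lie in the sheet \<open>V\<close>, so equal projections make
      them equal.\<close>
    then have "\<Psi> (p g) = g" using inj g by (auto dest: inj_onD)
    moreover have "joined (\<Psi> (p g))"
      unfolding \<Psi>_def by (intro joined_mul joined_gexp std_in_sl2)
    ultimately show ?thesis by simp
  qed
  ultimately show ?thesis by (rule that)
qed

text \<open>A connected topological group is generated by any neighbourhood of \<open>e\<close>: on
  each translate of \<open>N\<close>, being \<open>joined\<close> passes from one point to every
  other. Paths are needed later for lifting through \<open>\<Phi>\<close>.\<close>

lemma joined: "joined g"
proof -
  obtain N where N: "open N" "e \<in> N" "\<And>g. g \<in> N \<Longrightarrow> joined g" using nhd_e_joined by blast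
  show ?thesis
  proof (rule connected_induction_simple[where P = joined and a = e and S = UNIV])
    show "joined e" using N by blast
    fix a :: 'g
    have "open ((\<lambda>h. ginv a \<cdot> h) -` N)"
      using N(1) by (intro open_vimage continuous_on_mul continuous_on_const continuous_on_id)
    moreover have "joined y" if "joined x" "ginv a \<cdot> x \<in> N" "ginv a \<cdot> y \<in> N" for x y
    proof -
      have "joined (x \<cdot> ginv (ginv a \<cdot> x) \<cdot> (ginv a \<cdot> y))"
        by (rule joined_mul[OF joined_mul[OF that(1) joined_ginv[OF N(3)[OF that(2)]]] N(3)[OF that(3)]])
      moreover have "x \<cdot> ginv (ginv a \<cdot> x) = a"
      proof -
        have "a \<cdot> (ginv a \<cdot> x) \<cdot> ginv (ginv a \<cdot> x) = a" unfolding mul_assoc[of a] by simp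
        then show ?thesis by simp
      qed
      ultimately show ?thesis by simp
    qed
    ultimately show "\<exists>T. openin (top_of_set UNIV) T \<and> a \<in> T \<and> (\<forall>x\<in>T. \<forall>y\<in>T. joined x \<longrightarrow> joined y)"
      using N(2) by (intro exI[of _ "(\<lambda>h. ginv a \<cdot> h) -` N"]) auto
  qed (use connected_UNIV_g in simp_all)
qed

text \<open>Lift of the Iwasawa decomposition; \<open>exp w\<close> is the first column of the matrix, read as a complex number.\<close>

definition \<Phi> :: "complex \<Rightarrow> real \<Rightarrow> 'g" where
  "\<Phi> w x = Er (Im w) \<cdot> Ec (Re w) \<cdot> Eb x"

lemma \<Phi>_0 [simp]: "\<Phi> 0 0 = e"
  by (simp add: \<Phi>_def)

lemma p_\<Phi>: "p (\<Phi> w x) = mat22 (Re (exp w)) (Re (exp w) * x - exp (- Re w) * sin (Im w))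
    (Im (exp w)) (Im (exp w) * x + exp (- Re w) * cos (Im w))"
  by (simp add: \<Phi>_def p_mul p_E mat22_arith Re_exp Im_exp mult.commute)

lemma continuous_on_\<Phi>:
  assumes "continuous_on S f" "continuous_on S g"
  shows "continuous_on S (\<lambda>t. \<Phi> (f t) (g t))"
  unfolding \<Phi>_def by (intro continuous_on_mul continuous_on_E continuous_on_Re continuous_on_Im assms)

lemma Re_exp_Im_exp_square: "Re (exp w) * Re (exp w) + Im (exp w) * Im (exp w) = exp (2 * Re w)"
proof -
  have "Re (exp w) * Re (exp w) + Im (exp w) * Im (exp w) =
      exp (Re w) * exp (Re w) * ((sin (Im w))\<^sup>2 + (cos (Im w))\<^sup>2)"
    unfolding Re_exp Im_exp power2_eq_square by (simp only: algebra_simps)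
  then show ?thesis by (simp flip: exp_add)
qed

text \<open>Gram-Schmidt: the parameter of \<open>Eb\<close> is the coefficient of the second column
  along the first, and determinant 1 fixes the orthogonal remainder.\<close>

lemma p_eq_\<Phi>:
  assumes det: "\<alpha> * \<delta> - \<beta> * \<gamma> = 1" and w: "exp w = Complex \<alpha> \<gamma>"
  shows "mat22 \<alpha> \<beta> \<gamma> \<delta> = p (\<Phi> w ((\<alpha> * \<beta> + \<gamma> * \<delta>) / (\<alpha> * \<alpha> + \<gamma> * \<gamma>)))"
proof -
  define n where "n = exp (2 * Re w)"
  have n: "n > 0" "\<alpha> * \<alpha> + \<gamma> * \<gamma> = n"
    using Re_exp_Im_exp_square[of w] by (simp_all add: n_def w)
  have "exp (- Re w) = exp (Re w) / n" by (simp add: n_def exp_minus field_simps flip: exp_add)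
  then have e: "exp (- Re w) * sin (Im w) = \<gamma> / n" "exp (- Re w) * cos (Im w) = \<alpha> / n"
    using w Re_exp[of w] Im_exp[of w] by simp_all
  have "\<alpha> * (\<alpha> * \<beta> + \<gamma> * \<delta>) - \<gamma> = (\<alpha> * \<alpha> + \<gamma> * \<gamma>) * \<beta> + \<gamma> * (\<alpha> * \<delta> - \<beta> * \<gamma> - 1)"
    "\<gamma> * (\<alpha> * \<beta> + \<gamma> * \<delta>) + \<alpha> = (\<alpha> * \<alpha> + \<gamma> * \<gamma>) * \<delta> - \<alpha> * (\<alpha> * \<delta> - \<beta> * \<gamma> - 1)"
    by (simp_all add: algebra_simps)
  then have "\<alpha> * (\<alpha> * \<beta> + \<gamma> * \<delta>) - \<gamma> = n * \<beta>" "\<gamma> * (\<alpha> * \<beta> + \<gamma> * \<delta>) + \<alpha> = n * \<delta>"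
    using det n by simp_all
  then have "\<alpha> * ((\<alpha> * \<beta> + \<gamma> * \<delta>) / n) - \<gamma> / n = \<beta>" "\<gamma> * ((\<alpha> * \<beta> + \<gamma> * \<delta>) / n) + \<alpha> / n = \<delta>"
    using n(1) by (simp_all flip: diff_divide_distrib add_divide_distrib)
  then show ?thesis
    unfolding p_\<Phi> e n(2) w by simp
qed

text \<open>\<open>x\<close> is recovered as the Gram-Schmidt coefficient, but only
  \<open>exp w\<close> is visible in the first column; the loss of periods in \<open>w\<close> is
  what describes the kernel.\<close>

lemma p_\<Phi>_inj:
  assumes "p (\<Phi> w x) = p (\<Phi> w' x')"
  shows "exp w = exp w'" "x = x'"
proof -
  show "exp w = exp w'" using assms by (simp add: p_\<Phi> complex_eq_iff)
  have x: "x = (\<alpha> * \<beta> + \<gamma> * \<delta>) / (\<alpha> * \<alpha> + \<gamma> * \<gamma>)" if "p (\<Phi> w x) = mat22 \<alpha> \<beta> \<gamma> \<delta>" for w x \<alpha> \<beta> \<gamma> \<delta>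
  proof -
    define E c s where "E = exp (- Re w)" and "c = cos (Im w)" and "s = sin (Im w)"
    have \<alpha>\<gamma>: "\<alpha> = exp (Re w) * c" "\<gamma> = exp (Re w) * s"
      and \<beta>\<delta>: "\<beta> = \<alpha> * x - E * s" "\<delta> = \<gamma> * x + E * c"
      using that unfolding p_\<Phi> Re_exp Im_exp mat22_eq_iff by (auto simp: E_def c_def s_def)
    have "\<alpha> * \<beta> + \<gamma> * \<delta> = (\<alpha> * \<alpha> + \<gamma> * \<gamma>) * x + E * (\<gamma> * c - \<alpha> * s)"
      unfolding \<beta>\<delta> by (simp add: algebra_simps)
    also have "\<gamma> * c - \<alpha> * s = 0" unfolding \<alpha>\<gamma> by simp
    finally have "\<alpha> * \<beta> + \<gamma> * \<delta> = (\<alpha> * \<alpha> + \<gamma> * \<gamma>) * x" by simp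
    moreover have "\<alpha> * \<alpha> + \<gamma> * \<gamma> > 0"
      using Re_exp_Im_exp_square[of w] that by (simp add: p_\<Phi>)
    ultimately show ?thesis by (metis less_irrefl nonzero_mult_div_cancel_left)
  qed
  obtain \<alpha> \<beta> \<gamma> \<delta> where "p (\<Phi> w x) = mat22 \<alpha> \<beta> \<gamma> \<delta>" using p_cases by blast
  then show "x = x'" using x[of w x] x[of w' x'] assms by simp
qed

text \<open>The first column never vanishes, so it lifts through the complex exponential to
  \<open>w\<close>, and \<open>x\<close> is a continuous quotient. Uniqueness of lifts turns
  equality of projections into equality in the cover.\<close>

lemma \<Phi>_lift:
  assumes f: "continuous_on {0..1::real} f" "f 0 = \<Phi> w0 x0"
  obtains w x where "continuous_on {0..1} w" "continuous_on {0..1} x" "w 0 = w0" "x 0 = x0"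
    "\<And>t. t \<in> {0..1} \<Longrightarrow> f t = \<Phi> (w t) (x t)"
proof -
  define \<alpha> \<beta> \<gamma> \<delta> where "\<alpha> t = p (f t) $ 1 $ 1" and "\<beta> t = p (f t) $ 1 $ 2"
    and "\<gamma> t = p (f t) $ 2 $ 1" and "\<delta> t = p (f t) $ 2 $ 2" for t
  have M: "p (f t) = mat22 (\<alpha> t) (\<beta> t) (\<gamma> t) (\<delta> t)" for t
    by (simp add: \<alpha>_def \<beta>_def \<gamma>_def \<delta>_def mat22_eta)
  have det: "\<alpha> t * \<delta> t - \<beta> t * \<gamma> t = 1" for t
    using p_in_SL2[of "f t"] unfolding M by simp
  have cont: "continuous_on {0..1} \<alpha>" "continuous_on {0..1} \<beta>" "continuous_on {0..1} \<gamma>" "continuous_on {0..1} \<delta>"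
    unfolding \<alpha>_def \<beta>_def \<gamma>_def \<delta>_def
    by (intro continuous_on_component continuous_on_p f)+
  have nz: "\<alpha> t \<noteq> 0 \<or> \<gamma> t \<noteq> 0" for t using det[of t] by auto
  have "continuous_on {0..1} (\<lambda>t. Complex (\<alpha> t) (\<gamma> t))"
    unfolding Complex_eq by (intro continuous_intros cont)
  moreover have "(\<lambda>t. Complex (\<alpha> t) (\<gamma> t)) \<in> {0..1} \<rightarrow> - {0}"
    using nz by (auto simp: complex_eq_iff)
  moreover have "exp w0 = Complex (\<alpha> 0) (\<gamma> 0)"
    using f(2) by (simp add: \<alpha>_def \<gamma>_def p_\<Phi> complex_eq_iff)
  ultimately obtain w where w: "continuous_on {0..1} w" "w 0 = w0"
    "\<And>t. t \<in> {0..1} \<Longrightarrow> exp (w t) = Complex (\<alpha> t) (\<gamma> t)"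
    using covering_space_lift_interval[OF covering_space_exp_punctured_plane, of 0 1 "\<lambda>t. Complex (\<alpha> t) (\<gamma> t)" w0]
    by auto
  define x where "x t = (\<alpha> t * \<beta> t + \<gamma> t * \<delta> t) / (\<alpha> t * \<alpha> t + \<gamma> t * \<gamma> t)" for t
  have "\<alpha> t * \<alpha> t + \<gamma> t * \<gamma> t \<noteq> 0" for t using nz[of t] by (simp add: sum_squares_eq_zero_iff)
  then have x: "continuous_on {0..1} x"
    unfolding x_def by (intro continuous_intros cont) auto
  have p: "p (f t) = p (\<Phi> (w t) (x t))" if "t \<in> {0..1}" for t
    unfolding x_def M by (rule p_eq_\<Phi>[OF det w(3)[OF that]])
  have "x 0 = x0"
    using p_\<Phi>_inj(2)[of "w 0" "x 0" w0 x0] p[of 0] f(2) by simp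
  moreover have "f t = \<Phi> (w t) (x t)" if "t \<in> {0..1}" for t
    by (rule lift_eq[of "{0..1}" f "\<lambda>t. \<Phi> (w t) (x t)" 0])
       (use f w x p that \<open>x 0 = x0\<close> in \<open>auto intro: continuous_on_\<Phi>\<close>)
  ultimately show ?thesis using that[of w x] w x by blast
qed

lemma \<Phi>_surj: obtains w x where "g = \<Phi> w x"
proof -
  obtain f where f: "continuous_on {0..1::real} f" "f 0 = e" "f 1 = g"
    using joined[of g] unfolding joined_def by blast
  obtain w x where "\<And>t. t \<in> {0..1} \<Longrightarrow> f t = \<Phi> (w t) (x t)"
    using \<Phi>_lift[OF f(1), of 0 0] f(2) by (metis \<Phi>_0)
  from this[of 1] show ?thesis using that f(3) by simp
qed

lemma kernel_p:
  assumes "p g = mat 1"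
  obtains n :: int where "g = Er (2 * pi * n)"
proof -
  obtain w x where g: "g = \<Phi> w x" by (rule \<Phi>_surj)
  have "p (\<Phi> w x) = p (\<Phi> 0 0)" using assms g by simp
  from p_\<Phi>_inj[OF this] have "exp w = exp 0" "x = 0" by simp_all
  then obtain n :: int where "w = of_int (2 * n) * pi * \<i>" unfolding exp_eq by auto
  then have "Re w = 0" "Im w = 2 * pi * n" by simp_all
  then show ?thesis using that[of n] g \<open>x = 0\<close> by (simp add: \<Phi>_def)
qed

text \<open>Injectivity of \<open>\<Phi>\<close> follows, since two preimages differ by a whole
  number of turns. Loops then lift to loops in the product of the complex plane and the real line,
  where any two are linearly homotopic, and \<open>\<Phi>\<close> carries the homotopy back.\<close>

lemma simply_connected_if_rotations_infinite:
  assumes "\<And>n::nat. n > 0 \<Longrightarrow> Er (2 * pi * real n) \<noteq> e"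
  shows "simply_connected (UNIV :: 'g set)"
proof -
  have int: "n = 0" if "Er (2 * pi * real_of_int n) = e" for n :: int
  proof (rule ccontr)
    assume "n \<noteq> 0"
    have "Er (2 * pi * real (nat \<bar>n\<bar>)) = e"
    proof (cases "n \<ge> 0")
      case False
      have "Er (2 * pi * real_of_int n + 2 * pi * real_of_int (- n)) = Er (2 * pi * real_of_int n) \<cdot> Er (2 * pi * real_of_int (- n))"
        by (rule Er_add)
      then show ?thesis using that False by simp
    qed (use that in simp)
    then show False using assms[of "nat \<bar>n\<bar>"] \<open>n \<noteq> 0\<close> by simp
  qed
  have inj: "w = w' \<and> x = x'" if eq: "\<Phi> w x = \<Phi> w' x'" for w x w' x'
  proof -
    have "exp w = exp w'" and x: "x = x'" using p_\<Phi>_inj eq by metis+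
    then obtain n :: int where n: "w = w' + of_int (2 * n) * pi * \<i>" unfolding exp_eq by auto
    then have Re: "Re w = Re w'" and Im: "Im w = Im w' + 2 * pi * n" by simp_all
    have "Er (Im w') = Er (Im w)" using eq unfolding \<Phi>_def x Re by simp
    also have "\<dots> = Er (Im w') \<cdot> Er (2 * pi * n)" unfolding Im by (rule Er_add)
    finally have "Er (2 * pi * n) = e" by (metis mul_e(2) mul_left_cancel)
    then show ?thesis using int n x by simp
  qed
  have lift: "\<exists>l. path l \<and> pathfinish l = pathstart l \<and> (\<forall>t\<in>{0..1}. q t = \<Phi> (fst (l t)) (snd (l t)))"
    if q: "path q" "pathfinish q = pathstart q" for q :: "real \<Rightarrow> 'g"
  proof -
    obtain w0 x0 where 0: "q 0 = \<Phi> w0 x0" using \<Phi>_surj by blast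
    obtain w x where wx: "continuous_on {0..1} w" "continuous_on {0..1} x"
      "\<And>t. t \<in> {0..1} \<Longrightarrow> q t = \<Phi> (w t) (x t)"
      using \<Phi>_lift[of q w0 x0] q(1) 0 unfolding path_def by metis
    have "\<Phi> (w 1) (x 1) = \<Phi> (w 0) (x 0)"
      using q(2) wx(3)[of 0] wx(3)[of 1] by (simp add: pathfinish_def pathstart_def)
    then have "w 1 = w 0" "x 1 = x 0" using inj by blast+
    then show ?thesis
      using wx by (intro exI[of _ "\<lambda>t. (w t, x t)"])
        (auto simp: path_def pathfinish_def pathstart_def intro: continuous_on_Pair)
  qed
  show ?thesis
    unfolding simply_connected_def
  proof (intro allI impI, elim conjE)
    fix q q' :: "real \<Rightarrow> 'g"
    assume "path q" "pathfinish q = pathstart q" "path q'" "pathfinish q' = pathstart q'"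
    then obtain l l' where l: "path l" "pathfinish l = pathstart l" "\<And>t. t \<in> {0..1} \<Longrightarrow> q t = \<Phi> (fst (l t)) (snd (l t))"
      and l': "path l'" "pathfinish l' = pathstart l'" "\<And>t. t \<in> {0..1} \<Longrightarrow> q' t = \<Phi> (fst (l' t)) (snd (l' t))"
      using lift by metis
    have "homotopic_loops UNIV l l'"
      using l l' by (intro homotopic_loops_linear) auto
    then have "homotopic_loops UNIV ((\<lambda>z. \<Phi> (fst z) (snd z)) \<circ> l) ((\<lambda>z. \<Phi> (fst z) (snd z)) \<circ> l')"
      by (rule homotopic_loops_continuous_image)
         (auto intro!: continuous_on_\<Phi> continuous_on_fst continuous_on_snd continuous_on_id)
    then show "homotopic_loops UNIV q q'"
      unfolding homotopic_loops using l(3) l'(3) by (simp add: o_def)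
  qed
qed

lemma small_time_controllable_std:
  assumes "\<not> simply_connected (UNIV :: 'g set)"
  shows "g \<in> Ast0"
proof -
  have "\<exists>k::nat. k > 0 \<and> Er (2 * pi * real k) = e"
  proof (rule ccontr)
    assume "\<not> ?thesis"
    then have "simply_connected (UNIV :: 'g set)"
      by (intro simply_connected_if_rotations_infinite) blast
    then show False using assms by contradiction
  qed
  then obtain k :: nat where k: "k > 0" "Er (2 * pi * real k) = e" by blast
  have period: "Er (t + real m * (2 * pi * k)) = Er t" for t m
  proof (induction m)
    case (Suc m)
    have eq: "t + real (Suc m) * (2 * pi * k) = (t + real m * (2 * pi * k)) + 2 * pi * k"
      by (simp add: algebra_simps)
    have "Er (t + real (Suc m) * (2 * pi * k)) = Er (t + real m * (2 * pi * k)) \<cdot> Er (2 * pi * k)"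
      unfolding eq by (rule Er_add)
    also have "\<dots> = Er t" unfolding Suc k by simp
    finally show ?case .
  qed simp
  \<comment> \<open>Adding \<open>\<bar>n\<bar>\<close> periods of \<open>k\<close> turns each makes
    the angle nonnegative without changing the element.\<close>
  have kernel: "g \<in> Ast0" if "p g = mat 1" for g
  proof -
    obtain n :: int where n: "g = Er (2 * pi * n)" by (rule kernel_p[OF \<open>p g = mat 1\<close>])
    have "real_of_int n + real (nat \<bar>n\<bar>) * real k \<ge> 0"
    proof -
      have "real (nat \<bar>n\<bar>) * 1 \<le> real (nat \<bar>n\<bar>) * real k" using k by (intro mult_left_mono) auto
      then show ?thesis by linarith
    qed
    then have "2 * pi * (n + real (nat \<bar>n\<bar>) * k) \<ge> 0" by simp
    then have "2 * pi * n + real (nat \<bar>n\<bar>) * (2 * pi * k) \<ge> 0"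
      by (simp only: distrib_left mult_ac)
    from Er_in_Ast[OF this] show ?thesis unfolding period n .
  qed
  have pos: "g \<in> Ast0" if "p g = mat22 \<alpha> \<beta> \<gamma> \<delta>" "\<gamma> > 0" for g \<alpha> \<beta> \<gamma> \<delta>
  proof -
    have "\<alpha> * \<delta> - \<beta> * \<gamma> = 1" using p_in_SL2[of g] that by simp
    then have "p (lift22 \<alpha> \<gamma> \<delta>) = p g" using that by (simp add: p_lift22 field_simps)
    then have "p (g \<cdot> ginv (lift22 \<alpha> \<gamma> \<delta>)) = mat 1"
      using p_ginv(2)[of "lift22 \<alpha> \<gamma> \<delta>"] by (simp add: p_mul)
    then have "g \<cdot> ginv (lift22 \<alpha> \<gamma> \<delta>) \<cdot> lift22 \<alpha> \<gamma> \<delta> \<in> Ast0"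
      by (intro mul_in_Ast kernel lift22_in_Ast that)
    then show ?thesis by (simp add: mul_assoc)
  qed
  have nz: "g \<in> Ast0" if "p g = mat22 \<alpha> \<beta> \<gamma> \<delta>" "\<gamma> \<noteq> 0" for g \<alpha> \<beta> \<gamma> \<delta>
  proof (cases "\<gamma> > 0")
    case False
    \<comment> \<open>\<open>Er pi\<close> lies over minus the identity, so splitting it off
      reverses the sign of the lower left entry.\<close>
    obtain \<alpha>' \<beta>' \<gamma>' \<delta>' where h: "p (ginv (Er pi) \<cdot> g) = mat22 \<alpha>' \<beta>' \<gamma>' \<delta>'" using p_cases by blast
    have "p g = p (Er pi) ** p (ginv (Er pi) \<cdot> g)" by (simp flip: p_mul)
    then have "\<gamma> = - \<gamma>'" by (simp add: that h p_E mat22_arith)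
    then have "ginv (Er pi) \<cdot> g \<in> Ast0" using pos[OF h] False that by simp
    then have "Er pi \<cdot> (ginv (Er pi) \<cdot> g) \<in> Ast0" by (metis mul_in_Ast Er_in_Ast pi_ge_zero)
    then show ?thesis by simp
  qed (use pos that in blast)
  obtain \<alpha> \<beta> \<gamma> \<delta> where g: "p g = mat22 \<alpha> \<beta> \<gamma> \<delta>" "\<alpha> * \<delta> - \<beta> * \<gamma> = 1" by (rule p_cases)
  show ?thesis
  proof (cases "\<gamma> = 0")
    case True
    \<comment> \<open>Splitting off \<open>Ea 1\<close> leaves lower left entry
      \<open>- \<alpha>\<close>, which is nonzero by determinant 1.\<close>
    obtain \<alpha>' \<beta>' \<gamma>' \<delta>' where h: "p (ginv (Ea 1) \<cdot> g) = mat22 \<alpha>' \<beta>' \<gamma>' \<delta>'" using p_cases by blast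
    have "p g = p (Ea 1) ** p (ginv (Ea 1) \<cdot> g)" by (simp flip: p_mul)
    then have "\<alpha> = \<alpha>'" "\<gamma> = \<alpha>' + \<gamma>'" unfolding p_E h g(1) mat22_arith by simp_all
    then have "\<gamma>' \<noteq> 0" using True g(2) by auto
    then have "ginv (Ea 1) \<cdot> g \<in> Ast0" using nz[OF h] by simp
    moreover have "Ea 1 \<in> Ast0" using H_in_Ast[of 1 0 0] by (simp add: H_def)
    ultimately have "Ea 1 \<cdot> (ginv (Ea 1) \<cdot> g) \<in> Ast0" by (metis mul_in_Ast)
    then show ?thesis unfolding ginv_cancel .
  qed (use nz g in blast)
qed

end

section \<open>Reduction to the standard basis\<close>

text \<open>Since \<open>r X\<close> is a commutator with \<open>X\<close>, the trace of \<open>r X\<^sup>2\<close> vanishes.\<close>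

lemma sl2_eigenvector_nilpotent:
  assumes "X \<in> sl2" "Y \<in> sl2" "X ** Y - Y ** X = r *\<^sub>R X" "r \<noteq> 0"
  shows "X ** X = 0"
proof -
  obtain x y z where X: "X = mat22 x y z (- x)" using assms(1) by (rule sl2_coords)
  obtain x' y' z' where Y: "Y = mat22 x' y' z' (- x')" using assms(2) by (rule sl2_coords)
  have "x * x' + y * z' - (x' * x + y' * z) = r * x" "x * y' + y * - x' - (x' * y + y' * - x) = r * y"
    "z * x' + - x * z' - (z' * x + - x' * z) = r * z"
    using assms(3) unfolding X Y mat22_arith mat22_eq_iff by blast+
  then have eqs: "y * z' - y' * z = r * x" "2 * (x * y' - x' * y) = r * y" "2 * (z * x' - z' * x) = r * z"
    by algebra+
  have "2 * (r * (x * x + y * z)) = 2 * x * (r * x) + z * (r * y) + y * (r * z)"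
    by (simp add: algebra_simps)
  also have "\<dots> = 0" unfolding eqs[symmetric] by (simp add: algebra_simps)
  finally have "x * x + y * z = 0" using \<open>r \<noteq> 0\<close> by simp
  then show ?thesis by (simp add: X mat22_arith) (simp add: vec_eq_iff forall_2 mult.commute)
qed

text \<open>In the basis \<open>e1\<close>, \<open>e2\<close> constructed below, \<open>a\<close>
  maps \<open>e1\<close> to \<open>e2\<close> and kills \<open>e2\<close>, while \<open>b\<close>
  maps \<open>e2\<close> to \<open>e1\<close> and kills \<open>e1\<close>; \<open>P\<close> has this
  basis as its columns.\<close>

lemma sl2_triple_conj:
  assumes sl2: "a \<in> sl2" "b \<in> sl2" "c \<in> sl2" and "a \<noteq> 0"
    and br: "b ** a - a ** b = c" "a ** c - c ** a = 2 *\<^sub>R a" "b ** c - c ** b = - (2 *\<^sub>R b)"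
  obtains P Q where "P ** Q = mat 1" "Q ** P = mat 1"
    "a = P ** A0 ** Q" "b = P ** B0 ** Q" "c = P ** C0 ** Q"
proof -
  have aa: "a ** a = 0" using sl2_eigenvector_nilpotent[OF sl2(1,3) br(2)] by simp
  have bb: "b ** b = 0" using sl2_eigenvector_nilpotent[OF sl2(2,3), of "- 2"] br(3) by simp
  have sub: "X ** (Y - Z) = X ** Y - X ** Z" "(Y - Z) ** X = Y ** X - Z ** X" for X Y Z :: "real^2^2"
    by (simp_all add: matrix_matrix_mult_def vec_eq_iff sum_subtractf algebra_simps)
  \<comment> \<open>Expanding \<open>a ** c - c ** a\<close> with \<open>c = b ** a - a ** b\<close>
    and \<open>a ** a = 0\<close> leaves twice \<open>a ** b ** a\<close>.\<close>
  have aba: "a ** b ** a = a"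
  proof -
    have "2 *\<^sub>R a = a ** (b ** a) - a ** a ** b - (b ** (a ** a) - a ** b ** a)"
      unfolding br(2)[symmetric] br(1)[symmetric] sub by (simp add: matrix_mul_assoc)
    then have "2 *\<^sub>R a = 2 *\<^sub>R (a ** b ** a)"
      unfolding aa by (simp add: matrix_mul_assoc scaleR_2)
    then show ?thesis by simp
  qed
  obtain w where w: "a *v w \<noteq> 0"
    using \<open>a \<noteq> 0\<close> by (metis matrix_eq matrix_vector_mult_0)
  define e2 e1 where "e2 = a *v w" and "e1 = b *v e2"
  have e: "a *v e1 = e2" "a *v e2 = 0" "b *v e1 = 0" "b *v e2 = e1"
    by (simp_all add: e1_def e2_def matrix_vector_mul_assoc matrix_mul_assoc aba aa bb)
  define P :: "real^2^2" where "P = mat22 (e1 $ 1) (e2 $ 1) (e1 $ 2) (e2 $ 2)"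
  have Pv: "P *v x = x $ 1 *\<^sub>R e1 + x $ 2 *\<^sub>R e2" for x
    by (simp add: P_def vec_eq_iff forall_2 matrix_vector_mult_def sum_2 mult.commute)
  have "x = 0" if "P *v x = 0" for x
  proof -
    have *: "x $ 1 *\<^sub>R e1 + x $ 2 *\<^sub>R e2 = 0" using that Pv by simp
    \<comment> \<open>Applying \<open>a\<close> removes the \<open>e2\<close> term and isolates the
      first coefficient.\<close>
    have "a *v (x $ 1 *\<^sub>R e1 + x $ 2 *\<^sub>R e2) = x $ 1 *\<^sub>R e2"
      by (simp add: matrix_vector_right_distrib matrix_vector_mult_scaleR e)
    then have "x $ 1 = 0" using * w by (simp add: e2_def)
    then have "x $ 2 = 0" using * w by (simp add: e2_def)
    with \<open>x $ 1 = 0\<close> show ?thesis by (simp add: vec_eq_iff forall_2)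
  qed
  then obtain Q where QP: "Q ** P = mat 1"
    using matrix_left_invertible_ker[of P] by blast
  then have PQ: "P ** Q = mat 1" using matrix_left_right_inverse by blast
  have A: "a ** P = P ** A0" and B: "b ** P = P ** B0"
    unfolding matrix_eq
    by (simp_all add: Pv e A0_def B0_def matrix_vector_right_distrib matrix_vector_mult_scaleR
        flip: matrix_vector_mul_assoc)
       (simp_all add: matrix_vector_mult_def sum_2)
  have a: "a = P ** A0 ** Q" using A PQ by (metis matrix_mul_assoc matrix_mul_rid)
  have b: "b = P ** B0 ** Q" using B PQ by (metis matrix_mul_assoc matrix_mul_rid)
  have "c = P ** (B0 ** A0 - A0 ** B0) ** Q"
    unfolding br(1)[symmetric] a b sub by (simp add: conj_mult[OF QP])
  moreover have "B0 ** A0 - A0 ** B0 = C0" by (simp add: A0_def B0_def C0_def mat22_arith)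
  ultimately show ?thesis using that[OF PQ QP a b] by simp
qed

text \<open>Conjugation by an invertible matrix is both a group automorphism and a homeomorphism of
  \<open>SL2\<close>, so the change of basis can be absorbed in \<open>p\<close>, leaving the
  covering group itself untouched.\<close>

lemma cover_SL2_conj:
  assumes cover: "cover_SL2 mul e ginv p" and PQ: "P ** Q = mat 1" "Q ** P = mat 1"
  shows "cover_SL2 mul e ginv (\<lambda>g. Q ** p g ** P)"
proof -
  have det: "det Q * det P = 1" using PQ(2) det_mul[of Q P] by (simp add: det_I)
  have lin: "continuous_on S (\<lambda>M. X ** M ** Y)" for X Y :: "real^2^2" and S
    by (intro linear_continuous_on linear_conv_bounded_linear[THEN iffD1] linearI)
       (simp_all add: matrix_mult_add matrix_mult_scaleR)
  have "homeomorphism SL2 SL2 (\<lambda>M. Q ** M ** P) (\<lambda>M. P ** M ** Q)"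
    using det by (intro homeomorphismI lin) (auto simp: conj_inverse PQ SL2_def det_mul mult.commute)
  then have "covering_space UNIV ((\<lambda>M. Q ** M ** P) \<circ> p) SL2"
    using cover by (intro covering_space_compose_homeomorphism) (auto simp: cover_SL2_def)
  then show ?thesis
    using cover by (simp add: cover_SL2_def o_def conj_mult[OF PQ(1)])
qed

text \<open>The same paths satisfy the two lifting conditions.\<close>

lemma lexp_conj:
  assumes X: "X \<in> sl2" and PQ: "P ** Q = mat 1" "Q ** P = mat 1"
  shows "lexp e p (P ** X ** Q) = lexp e (\<lambda>g. Q ** p g ** P) X"
proof -
  have "p g = mexp (t *\<^sub>R (P ** X ** Q)) \<longleftrightarrow> Q ** p g ** P = mexp (t *\<^sub>R X)" for g t
  proof -
    have "mexp (t *\<^sub>R (P ** X ** Q)) = P ** mexp (t *\<^sub>R X) ** Q"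
      using mexp_conj[OF sl2_scaleR[OF X] PQ, of t] by (simp add: matrix_mult_scaleR)
    then show ?thesis using conj_inverse[OF PQ(1)] conj_inverse[OF PQ(2)] by metis
  qed
  then show ?thesis unfolding lexp_def by (simp only:)
qed

theorem theorem5:
  fixes mul :: "'g::topological_space \<Rightarrow> 'g \<Rightarrow> 'g" and e :: 'g and ginv :: "'g \<Rightarrow> 'g"
    and p :: "'g \<Rightarrow> real^2^2" and a b c :: "real^2^2"
  assumes "cover_SL2 mul e ginv p"
    and "a \<in> sl2" "b \<in> sl2" "c \<in> sl2"
    and "a \<noteq> b" "a \<noteq> c" "b \<noteq> c" "independent {a, b, c}"
    and "b ** a - a ** b = c"
    and "a ** c - c ** a = 2 *\<^sub>R a"
    and "b ** c - c ** b = - (2 *\<^sub>R b)"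
  shows "good_bracket mul e p a b b \<and> good_bracket mul e p a b c \<and>
         (\<forall>t1\<ge>0. lexp e p (t1 *\<^sub>R (a - b)) \<in> closure (Ast mul e p a b)) \<and>
         (\<not> simply_connected (UNIV :: 'g set) \<longrightarrow> small_time_controllable mul e p a b)"
proof -
  have "a \<noteq> 0" using \<open>independent {a, b, c}\<close> dependent_zero by blast
  then obtain P Q where PQ: "P ** Q = mat 1" "Q ** P = mat 1"
    and abc: "a = P ** A0 ** Q" "b = P ** B0 ** Q" "c = P ** C0 ** Q"
    using sl2_triple_conj assms by metis
  \<comment> \<open>With respect to \<open>p'\<close> the system is the standard one on the same
    group, and its small-time reachable set is the same.\<close>
  define p' where "p' = (\<lambda>g. Q ** p g ** P)"
  interpret sl2_cover mul e ginv p'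
    unfolding p'_def using cover_SL2_conj[OF assms(1) PQ] by unfold_locales
  have lexp: "lexp e p (P ** X ** Q) = lexp e p' X" if "X \<in> sl2" for X
    unfolding p'_def by (rule lexp_conj[OF that PQ])
  have ab: "t *\<^sub>R (a + u *\<^sub>R b) = P ** (t *\<^sub>R (A0 + u *\<^sub>R B0)) ** Q" for t u
    unfolding abc by (simp add: matrix_mult_add matrix_mult_scaleR)
  have "lexp e p (t *\<^sub>R (a + u *\<^sub>R b)) = lexp e p' (t *\<^sub>R (A0 + u *\<^sub>R B0))" for t u
    unfolding ab by (intro lexp sl2_scaleR std_in_sl2)
  then have Ast: "Ast mul e p a b = Ast mul e p' A0 B0"
    unfolding Ast_def endpoint_def by simp
  have b: "lexp e p (v *\<^sub>R b) = Eb v" and c: "lexp e p (v *\<^sub>R c) = Ec v" for v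
    using lexp[OF sl2_scaleR[OF std_in_sl2(2)], of v] lexp[OF sl2_scaleR[OF std_in_sl2(3)], of v]
    unfolding abc by (simp_all add: matrix_mult_scaleR)
  have r: "lexp e p (v *\<^sub>R (a - b)) = Er v" for v
    using lexp[OF sl2_scaleR[OF std_in_sl2(4)], of v] ab[of 1 "- 1"]
    by (simp add: matrix_mult_scaleR)
  show ?thesis
    unfolding good_bracket_def small_time_controllable_def Ast b c r
    using Eb_in_closure Ec_in_closure closure_subset[THEN subsetD, OF Er_in_Ast] small_time_controllable_std
    by (intro conjI allI impI) auto
qed

end
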